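(* Consider the constrained two-player nonzero-sum difference game (CNZDG) described in the context. Assume: (a) the admissible sets $\mathsf U_k(x_k)\subset\mathbb R^m$, $k\in\mathsf K_l$, are such that for all $k\in\mathsf K$ (and all $x_k\in\mathsf X_k$) the sets $\mathsf V_k(x_k)$ are nonempty, convex, closed and bounded; the functions $f_k$ ($k\in\mathsf K_l$), $h_k^i,g_k^i$ ($k\in\mathsf K$, $i\in\{1,2\}$) are continuously differentiable; and the matrices $\partial h_k^i/\partial v_k^i$ ($k\in\mathsf K$, $i\in\{1,2\}$) have full rank for each $\mathsf v_k\in\mathsf V_k(x_k)$ and $x_k\in\mathsf X_k$; (b) (separability) for all $k\in\mathsf K_l$, $i\in\{1,2\}$, $g_k^i(x_k,\mathsf u_k,\mathsf v_k)=g_{u,k}^i(x_k,\mathsf u_k)+g_{v,k}^i(x_k,\mathsf v_k)$ (and $g_{v,K}^i:=g_K^i$); (c) (diagonal strict convexity) for every $k\in\mathsf K$, $x_k\in\mathsf X_k$ and all $\boldsymbol\alpha\neq\boldsymbol\beta$ in $\mathbb R^s$, $(\boldsymbol\alpha-\boldsymbol\beta)'\nabla g_{v,k}(x_k,\boldsymbol\beta)+(\boldsymbol\beta-\boldsymbol\alpha)'\nabla g_{v,k}(x_k,\boldsymbol\alpha)<0$, where $\nabla g_{v,k}(x_k,\mathsf v_k)=\mathrm{col}(\nabla_{v_k^1}g_{v,k}^1(x_k,\mathsf v_k),\nabla_{v_k^2}g_{v,k}^2(x_k,\mathsf v_k))$. Suppose there exist functions $W^i(k,\cdot):\mathsf X_k\to\mathbb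 R$, $k\in\mathsf K$, $i\in\{1,2\}$, such that for all $k\in\mathsf K_l$ and $\gamma_k^1\in\Gamma_k^1$ the function $g_{u,k}^2(x_k,\gamma_k^1(x_k),\cdot)+W^2(k+1,f_k(x_k,\gamma_k^1(x_k),\cdot))$ is strictly convex on $\mathsf U_k^2$, and such that the following backward recursion holds: 1) at period $K$: $W^i(K,x_K)=g_K^i(x_K,(v_K^{1\star},v_K^{2\star}))$, $i\in\{1,2\}$, where $(\mathsf v_K^\star,\mu_K^\star)=\mathrm{SOL}(\mathrm{pCP}_K(x_K))$; 2) at periods $k=K-1,\dots,1,0$: $$W^i(k,x_k)=g_k^i\big(x_k,(\gamma_k^{1\star}(x_k),\gamma_k^{2\star}(x_k)),(v_k^{1\star},v_k^{2\star})\big)+W^i\big(k+1,f_k(x_k,\gamma_k^{1\star}(x_k),\gamma_k^{2\star}(x_k))\big),\quad i\in\{1,2\},$$ where $$(\mathsf v_k^\star,\mu_k^\star)=\mathrm{SOL}(\mathrm{pCP}_k(x_k)),$$ $$\mathsf R_k^2(\gamma_k^1)=\arg\min_{\gamma_k^2\in\Gamma_k^2}\big\{g_{u,k}^2(x_k,\gamma_k^1(x_k),\gamma_k^2(x_k))+W^2(k+1,f_k(x_k,\gamma_k^1(x_k),\gamma_k^2(x_k)))\big\},$$ $$\gamma_k^{1\star}\in\arg\min_{\gamma_k^1\in\Gamma_k^1}\big\{g_{u,k}^1(x_k,\gamma_k^1(x_k),(\mathsf R_k^2\circ\gamma_k^1)(x_k))+W^1(k+1,f_k(x_k,\gamma_k^1(x_k),(\mathsf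 R_k^2\circ\gamma_k^1)(x_k)))\big\},$$ $$\gamma_k^{2\star}=\mathsf R_k^2(\gamma_k^{1\star}).$$ Then the pair of strategies $\psi^{i\star}=((\gamma_k^{i\star}(x_k),v_k^{i\star})_{k\in\mathsf K_l},v_K^{i\star})$, $i=1,2$, constitutes a feedback Stackelberg-Nash (FSN) solution for CNZDG. Further, every such FSN solution is strongly time consistent.
   Context: Notation: $A'$ is the transpose of $A$; $\mathrm{col}(\cdot)$ stacks vectors; $0\le x\perp y\ge0$ means $x\ge0,\ y\ge0,\ x'y=0$. CNZDG. Players: $1$ (leader), $2$ (follower). $\mathsf K=\{0,\dots,K\}$, $\mathsf K_l=\mathsf K\setminus\{K\}$, $\mathsf K_r=\mathsf K\setminus\{0\}$. State $x_k\in\mathbb R^n$, $x_0$ given, $x_{k+1}=f_k(x_k,u_k^1,u_k^2)$ for $k\in\mathsf K_l$, with $u_k^i\in\mathbb R^{m_i}$, $m=m_1+m_2$. For each $k\in\mathsf K$ each player also has $v_k^i\in\mathbb R^{s_i}$, $s=s_1+s_2$, with coupled constraints $h_k^i(x_k,v_k^1,v_k^2)\ge0$, $v_k^i\ge0$, $h_k^i:\mathbb R^n\times\mathbb R^s\to\mathbb R^{c_i}$. Write $\mathsf u_k=(u_k^1,u_k^2)$, $\mathsf v_k=(v_k^1,v_k^2)$. Player $i$ minimizes $J_i=g_K^i(x_K,\mathsf v_K)+\sum_{k=0}^{K-1}g_k^i(x_k,\mathsf u_k,\mathsf v_k)$. Admissible sets: $\mathsf V_k(x)=\{(v^1,v^2)\in\mathbb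 R^s: h_k^i(x,v^1,v^2)\ge0,\ v^i\ge0,\ i=1,2\}$; $\mathsf U_k(x)=\{(u^1,u^2)\in\mathbb R^m:\mathsf V_{k+1}(f_k(x,u^1,u^2))\neq\emptyset\}$, $k\in\mathsf K_l$; $\mathsf U_k^i$ (resp. $\mathsf V_k^i(v_k^j)$) is the set of $u_k^i$ (resp. $v_k^i$) such that, with the other player's action given, the pair lies in $\mathsf U_k(x_k)$ (resp. $\mathsf V_k(x_k)$). $\mathsf X_0=\{x_0\}$ and for $k\in\mathsf K_r$, $\mathsf X_k$ is the set of states reachable at time $k$ by sequences $(u_\tau^1,u_\tau^2)\in\mathsf U_\tau(x_\tau)$, $\tau=0,\dots,k-1$. Strategies: $u_k^i=\gamma_k^i(x_k)$ with $\gamma_k^i\in\Gamma_k^i$, the set of measurable maps $\mathsf X_k\to\mathsf U_k^i$ (pairs are jointly admissible: $(\gamma_k^1(x),\gamma_k^2(x))\in\mathsf U_k(x)$); $v_k^i\in\mathsf V_k^i$ is chosen at the current state $x_k$. $\psi_k^i=(\gamma_k^i,v_k^i)$ for $k\in\mathsf K_l$, $\psi_K^i=v_K^i$, $\psi^i=(\psi_0^i,\dots,\psi_K^i)$, $\psi^i_{[a,b]}=(\psi_a^i,\dots,\psi_b^i)$. Minimizations over maps $\gamma_k^i$ are understood at every state $x_k\in\mathsf X_k$; $(\mathsf R_k^2\circ\gamma_k^1)(x_k)$ is the value at $x_k$ of $\mathsf R_k^2(\gamma_k^1)$. FSN solution: $(\psi^{1\star},\psi^{2\star})$ such that: (1)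 for all admissible upstream strategies $\psi^i_{[0,K-1]}$ (equivalently at every reachable $x_K$), $(v_K^{1\star},v_K^{2\star})\in\mathsf V_K(x_K)$ and each $v_K^{i\star}$ minimizes $J_i$ over $v_K^i\in\mathsf V_K^i(v_K^{j\star})$, $j\ne i$, the other player using $v_K^{j\star}$; (2) recursively for $k=K-1,\dots,0$, for all admissible upstream strategies $\psi^i_{[0,k-1]}$ (equivalently at every $x_k\in\mathsf X_k$), with downstream strategies fixed at $\psi^{i\star}_{[k+1,K]}$: (third stage) for all $\gamma_k^1,\gamma_k^2$, $(v_k^{1\star},v_k^{2\star})\in\mathsf V_k(x_k)$ and each $v_k^{i\star}$ minimizes $J_i$ over $\mathsf V_k^i(v_k^{j\star})$; (second stage) for every $\gamma_k^1\in\Gamma_k^1$ the follower has a unique response $\mathsf R_k^2(\gamma_k^1)=\arg\min_{\gamma_k^2\in\Gamma_k^2}J_2$ with third-stage decisions fixed at $(v_k^{1\star},v_k^{2\star})$; (first stage) $\gamma_k^{1\star}$ minimizes $J_1$ over $\gamma_k^1\in\Gamma_k^1$ when the follower plays $\mathsf R_k^2(\gamma_k^1)$ and third-stage decisions are $(v_k^{1\star},v_k^{2\star})$; and $\gamma_k^{2\star}=\mathsf R_k^2(\gamma_k^{1\star})$. Strong time consistency (standard): for every $k$ and every $x_k\in\mathsf X_k$ (whatever admissible strategies were used before $k$), the truncation $(\psi^{1\star}_{[k,K]},\psi^{2\star}_{[k,K]})$ is an FSN solution of the subgame starting at $(k,x_k)$. Complementarity problem: $\mathrm{pCP}_k(x_k)$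 is to find $(\mathsf v_k^\star,\mu_k^\star)$, $\mu_k^\star=\mathrm{col}(\mu_k^{1\star},\mu_k^{2\star})\in\mathbb R^{c_1+c_2}$, with $$0\le\begin{bmatrix}\nabla L_k(x_k,\mathsf v_k^\star,\mu_k^\star)\\ h_k(x_k,\mathsf v_k^\star)\end{bmatrix}\perp\begin{bmatrix}\mathsf v_k^\star\\ \mu_k^\star\end{bmatrix}\ge0,$$ where $\nabla L_k=\mathrm{col}\big(\nabla_{v_k^i}g_{v,k}^i(x_k,\mathsf v_k^\star)-(\partial h_k^i/\partial v_k^i(x_k,\mathsf v_k^\star))'\mu_k^{i\star}\big)_{i=1}^2$ and $h_k=\mathrm{col}(h_k^1,h_k^2)$. $\mathrm{SOL}(\cdot)$ denotes its solution, which under (a)-(c) is taken to be unique. *)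

theory Defs
  imports "HOL-Analysis.Analysis"
begin

subsection \<open>Calculus\<close>

definition continuously_differentiable ::
    "('a::real_normed_vector \<Rightarrow> 'b::real_normed_vector) \<Rightarrow> bool" where
  "continuously_differentiable f \<longleftrightarrow>
    (\<exists>f'. (\<forall>z. (f has_derivative blinfun_apply (f' z)) (at z)) \<and> continuous_on UNIV f')"

definition grad :: "(real^'d \<Rightarrow> real) \<Rightarrow> real^'d \<Rightarrow> real^'d" where
  "grad F v = (\<chi> j. frechet_derivative F (at v) (axis j 1))"

definition full_rank :: "real^'d^'c \<Rightarrow> bool" where
  "full_rank A \<longleftrightarrow> rank A = min CARD('c) CARD('d)"

text \<open>As for the library's \<^const>\<open>convex_on\<close>, convexity of the domain is part of the notion.\<close>

definition strictly_convex_on :: "'a::real_vector set \<Rightarrow> ('a \<Rightarrow> real) \<Rightarrow> bool" where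
  "strictly_convex_on S f \<longleftrightarrow> convex S \<and>
    (\<forall>a\<in>S. \<forall>b\<in>S. \<forall>t. a \<noteq> b \<and> 0 < t \<and> t < 1 \<longrightarrow>
       f ((1 - t) *\<^sub>R a + t *\<^sub>R b) < (1 - t) * f a + t * f b)"

text \<open>The order on vectors, and on pairs of vectors, is componentwise.\<close>

definition complementary :: "'a::ordered_euclidean_space \<Rightarrow> 'a \<Rightarrow> bool" where
  "complementary a b \<longleftrightarrow> 0 \<le> a \<and> 0 \<le> b \<and> a \<bullet> b = 0"


subsection \<open>The game\<close>

datatype player = Leader | Follower

text \<open>
  The two players' actions have different dimensions, hence the separate types.
  The periods are \<open>0, \<dots>, hor\<close>; values of the fields at other periods are irrelevant
  (\<open>hor\<close> itself being excluded for \<open>dyn\<close> and \<open>cost\<close>).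
\<close>

record ('n::finite, 'm1::finite, 'm2::finite, 's1::finite, 's2::finite, 'c1::finite, 'c2::finite)
    cnzdg =
  hor :: nat
  init :: "real^'n"
  dyn :: "nat \<Rightarrow> real^'n \<Rightarrow> (real^'m1) \<times> (real^'m2) \<Rightarrow> real^'n"
  con1 :: "nat \<Rightarrow> real^'n \<Rightarrow> (real^'s1) \<times> (real^'s2) \<Rightarrow> real^'c1"
  con2 :: "nat \<Rightarrow> real^'n \<Rightarrow> (real^'s1) \<times> (real^'s2) \<Rightarrow> real^'c2"
  cost :: "player \<Rightarrow> nat \<Rightarrow> real^'n \<Rightarrow> (real^'m1) \<times> (real^'m2) \<Rightarrow> (real^'s1) \<times> (real^'s2) \<Rightarrow> real"
  term_cost :: "player \<Rightarrow> real^'n \<Rightarrow> (real^'s1) \<times> (real^'s2) \<Rightarrow> real"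

text \<open>
  A strategy of one player: \<open>ctl \<psi> k\<close> is the map \<open>\<gamma>\<^sub>k\<close>, and \<open>aux \<psi> k x\<close> is the decision
  \<open>v\<^sub>k\<close> chosen at the current state \<open>x\<close>.  Only the values at reachable states matter.
\<close>

record ('n::finite, 'm::finite, 's::finite) strategy =
  ctl :: "nat \<Rightarrow> real^'n \<Rightarrow> real^'m"
  aux :: "nat \<Rightarrow> real^'n \<Rightarrow> real^'s"

type_synonym ('n, 'm1, 'm2) ctl_pair = "(real^'n \<Rightarrow> real^'m1) \<times> (real^'n \<Rightarrow> real^'m2)"

context
  fixes G :: "('n::finite, 'm1::finite, 'm2::finite, 's1::finite, 's2::finite,
    'c1::finite, 'c2::finite) cnzdg"
begin

definition V_set :: "nat \<Rightarrow> real^'n \<Rightarrow> ((real^'s1) \<times> (real^'s2)) set" where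
  "V_set k x = {(v1, v2). 0 \<le> con1 G k x (v1, v2) \<and> 0 \<le> con2 G k x (v1, v2) \<and> 0 \<le> v1 \<and> 0 \<le> v2}"

definition V1_set :: "nat \<Rightarrow> real^'n \<Rightarrow> real^'s2 \<Rightarrow> (real^'s1) set" where
  "V1_set k x v2 = {v1. (v1, v2) \<in> V_set k x}"

definition V2_set :: "nat \<Rightarrow> real^'n \<Rightarrow> real^'s1 \<Rightarrow> (real^'s2) set" where
  "V2_set k x v1 = {v2. (v1, v2) \<in> V_set k x}"

definition U_set :: "nat \<Rightarrow> real^'n \<Rightarrow> ((real^'m1) \<times> (real^'m2)) set" where
  "U_set k x = {u. V_set (Suc k) (dyn G k x u) \<noteq> {}}"

definition U2_set :: "nat \<Rightarrow> real^'n \<Rightarrow> real^'m1 \<Rightarrow> (real^'m2) set" where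
  "U2_set k x u1 = {u2. (u1, u2) \<in> U_set k x}"

primrec X_set :: "nat \<Rightarrow> (real^'n) set" where
  "X_set 0 = {init G}"
| "X_set (Suc k) = {dyn G k x u | x u. x \<in> X_set k \<and> u \<in> U_set k x}"

text \<open>
  Admissibility of maps is a joint condition on the pair; \<open>Gamma1_set k\<close> contains the leader's maps
  that some follower map complements to an admissible pair, and \<open>Gamma2_set k \<gamma>1\<close> contains the
  follower maps that are admissible given \<open>\<gamma>1\<close>.
\<close>

definition Gamma_set :: "nat \<Rightarrow> ('n, 'm1, 'm2) ctl_pair set" where
  "Gamma_set k = {(\<gamma>1, \<gamma>2).
     \<gamma>1 \<in> borel_measurable (restrict_space borel (X_set k)) \<and>
     \<gamma>2 \<in> borel_measurable (restrict_space borel (X_set k)) \<and>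
     (\<forall>x\<in>X_set k. (\<gamma>1 x, \<gamma>2 x) \<in> U_set k x)}"

definition Gamma1_set :: "nat \<Rightarrow> (real^'n \<Rightarrow> real^'m1) set" where
  "Gamma1_set k = {\<gamma>1. \<exists>\<gamma>2. (\<gamma>1, \<gamma>2) \<in> Gamma_set k}"

definition Gamma2_set :: "nat \<Rightarrow> (real^'n \<Rightarrow> real^'m1) \<Rightarrow> (real^'n \<Rightarrow> real^'m2) set" where
  "Gamma2_set k \<gamma>1 = {\<gamma>2. (\<gamma>1, \<gamma>2) \<in> Gamma_set k}"

primrec traj ::
    "('n, 'm1, 's1) strategy \<Rightarrow> ('n, 'm2, 's2) strategy \<Rightarrow> nat \<Rightarrow> real^'n" where
  "traj \<psi>1 \<psi>2 0 = init G"
| "traj \<psi>1 \<psi>2 (Suc k) =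
     dyn G k (traj \<psi>1 \<psi>2 k) (ctl \<psi>1 k (traj \<psi>1 \<psi>2 k), ctl \<psi>2 k (traj \<psi>1 \<psi>2 k))"

definition total_cost ::
    "player \<Rightarrow> ('n, 'm1, 's1) strategy \<Rightarrow> ('n, 'm2, 's2) strategy \<Rightarrow> real" where
  "total_cost i \<psi>1 \<psi>2 =
    (let x = traj \<psi>1 \<psi>2; K = hor G in
      term_cost G i (x K) (aux \<psi>1 K (x K), aux \<psi>2 K (x K)) +
      (\<Sum>k<K. cost G i k (x k) (ctl \<psi>1 k (x k), ctl \<psi>2 k (x k)) (aux \<psi>1 k (x k), aux \<psi>2 k (x k))))"

end


subsection \<open>FSN solutions\<close>

text \<open>\<open>splice k \<phi> \<psi>\<close> is \<open>\<phi>\<close> on periods \<open>0, \<dots>, k - 1\<close> followed by \<open>\<psi>\<close> from period \<open>k\<close> on.\<close>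

definition splice ::
    "nat \<Rightarrow> ('n::finite, 'm::finite, 's::finite) strategy \<Rightarrow> ('n, 'm, 's) strategy \<Rightarrow> ('n, 'm, 's) strategy"
  where
  "splice k \<phi> \<psi> = \<lparr>ctl = (\<lambda>j. if j < k then ctl \<phi> j else ctl \<psi> j),
                   aux = (\<lambda>j. if j < k then aux \<phi> j else aux \<psi> j)\<rparr>"

definition set_ctl ::
    "nat \<Rightarrow> (real^'n \<Rightarrow> real^'m) \<Rightarrow> ('n::finite, 'm::finite, 's::finite) strategy \<Rightarrow> ('n, 'm, 's) strategy"
  where "set_ctl k \<gamma> \<psi> = \<psi>\<lparr>ctl := (ctl \<psi>)(k := \<gamma>)\<rparr>"

definition set_aux ::
    "nat \<Rightarrow> real^'s \<Rightarrow> ('n::finite, 'm::finite, 's::finite) strategy \<Rightarrow> ('n, 'm, 's) strategy"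
  where "set_aux k w \<psi> = \<psi>\<lparr>aux := (aux \<psi>)(k := (\<lambda>_. w))\<rparr>"

context
  fixes G :: "('n::finite, 'm1::finite, 'm2::finite, 's1::finite, 's2::finite,
    'c1::finite, 'c2::finite) cnzdg"
begin

definition upstream_admissible ::
    "nat \<Rightarrow> ('n, 'm1, 's1) strategy \<Rightarrow> ('n, 'm2, 's2) strategy \<Rightarrow> bool" where
  "upstream_admissible k \<phi>1 \<phi>2 \<longleftrightarrow>
    (\<forall>j<k. (ctl \<phi>1 j, ctl \<phi>2 j) \<in> Gamma_set G j \<and>
           (\<forall>x\<in>X_set G j. (aux \<phi>1 j x, aux \<phi>2 j x) \<in> V_set G j x))"

text \<open>
  The third-stage condition at period \<open>k\<close>: given everything else in \<open>\<psi>1, \<psi>2\<close>, the pair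
  \<open>(v\<^sub>k\<^sup>1, v\<^sub>k\<^sup>2)\<close> is a Nash equilibrium at the current state.
\<close>

definition third_stage_nash ::
    "nat \<Rightarrow> ('n, 'm1, 's1) strategy \<Rightarrow> ('n, 'm2, 's2) strategy \<Rightarrow> bool" where
  "third_stage_nash k \<psi>1 \<psi>2 \<longleftrightarrow>
    (let x = traj G \<psi>1 \<psi>2 k; v1 = aux \<psi>1 k x; v2 = aux \<psi>2 k x in
      (v1, v2) \<in> V_set G k x \<and>
      (\<forall>w\<in>V1_set G k x v2.
         total_cost G Leader \<psi>1 \<psi>2 \<le> total_cost G Leader (set_aux k w \<psi>1) \<psi>2) \<and>
      (\<forall>w\<in>V2_set G k x v1.
         total_cost G Follower \<psi>1 \<psi>2 \<le> total_cost G Follower \<psi>1 (set_aux k w \<psi>2)))"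

text \<open>
  \<open>stage_cost i \<psi>1 \<psi>2 k \<phi>1 \<phi>2 \<gamma>1 \<gamma>2\<close> is \<open>J\<^sub>i\<close> when \<open>\<phi>\<close> is played upstream of \<open>k\<close>, the maps
  \<open>\<gamma>1, \<gamma>2\<close> at \<open>k\<close>, and \<open>\<psi>\<close> for the third-stage decision at \<open>k\<close> and downstream.
\<close>

definition stage_cost ::
    "player \<Rightarrow> ('n, 'm1, 's1) strategy \<Rightarrow> ('n, 'm2, 's2) strategy \<Rightarrow> nat \<Rightarrow>
     ('n, 'm1, 's1) strategy \<Rightarrow> ('n, 'm2, 's2) strategy \<Rightarrow>
     (real^'n \<Rightarrow> real^'m1) \<Rightarrow> (real^'n \<Rightarrow> real^'m2) \<Rightarrow> real" where
  "stage_cost i \<psi>1 \<psi>2 k \<phi>1 \<phi>2 \<gamma>1 \<gamma>2 =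
     total_cost G i (set_ctl k \<gamma>1 (splice k \<phi>1 \<psi>1)) (set_ctl k \<gamma>2 (splice k \<phi>2 \<psi>2))"

definition responses ::
    "('n, 'm1, 's1) strategy \<Rightarrow> ('n, 'm2, 's2) strategy \<Rightarrow> nat \<Rightarrow>
     (real^'n \<Rightarrow> real^'m1) \<Rightarrow> (real^'n \<Rightarrow> real^'m2) set" where
  "responses \<psi>1 \<psi>2 k \<gamma>1 = {\<gamma>2 \<in> Gamma2_set G k \<gamma>1.
     \<forall>\<phi>1 \<phi>2. upstream_admissible k \<phi>1 \<phi>2 \<longrightarrow>
       (\<forall>\<eta>\<in>Gamma2_set G k \<gamma>1.
          stage_cost Follower \<psi>1 \<psi>2 k \<phi>1 \<phi>2 \<gamma>1 \<gamma>2 \<le> stage_cost Follower \<psi>1 \<psi>2 k \<phi>1 \<phi>2 \<gamma>1 \<eta>)}"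

text \<open>Uniqueness is as a map on \<open>X\<^sub>k\<close>.\<close>

definition unique_response_map ::
    "('n, 'm1, 's1) strategy \<Rightarrow> ('n, 'm2, 's2) strategy \<Rightarrow> nat \<Rightarrow>
     ((real^'n \<Rightarrow> real^'m1) \<Rightarrow> (real^'n \<Rightarrow> real^'m2)) \<Rightarrow> bool" where
  "unique_response_map \<psi>1 \<psi>2 k R \<longleftrightarrow>
     (\<forall>\<gamma>1\<in>Gamma1_set G k. R \<gamma>1 \<in> responses \<psi>1 \<psi>2 k \<gamma>1 \<and>
        (\<forall>\<gamma>2\<in>responses \<psi>1 \<psi>2 k \<gamma>1. \<forall>x\<in>X_set G k. \<gamma>2 x = R \<gamma>1 x))"

definition FSN_solution ::
    "('n, 'm1, 's1) strategy \<Rightarrow> ('n, 'm2, 's2) strategy \<Rightarrow> bool" where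
  "FSN_solution \<psi>1 \<psi>2 \<longleftrightarrow>
    (\<forall>\<phi>1 \<phi>2. upstream_admissible (hor G) \<phi>1 \<phi>2 \<longrightarrow>
       third_stage_nash (hor G) (splice (hor G) \<phi>1 \<psi>1) (splice (hor G) \<phi>2 \<psi>2)) \<and>
    (\<forall>k<hor G.
       (\<forall>\<phi>1 \<phi>2. upstream_admissible k \<phi>1 \<phi>2 \<longrightarrow>
          (\<forall>(\<gamma>1, \<gamma>2)\<in>Gamma_set G k.
             third_stage_nash k (set_ctl k \<gamma>1 (splice k \<phi>1 \<psi>1)) (set_ctl k \<gamma>2 (splice k \<phi>2 \<psi>2)))) \<and>
       (\<exists>R. unique_response_map \<psi>1 \<psi>2 k R \<and>
          ctl \<psi>1 k \<in> Gamma1_set G k \<and>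
          (\<forall>\<phi>1 \<phi>2. upstream_admissible k \<phi>1 \<phi>2 \<longrightarrow>
             (\<forall>\<gamma>1\<in>Gamma1_set G k.
                stage_cost Leader \<psi>1 \<psi>2 k \<phi>1 \<phi>2 (ctl \<psi>1 k) (R (ctl \<psi>1 k))
                  \<le> stage_cost Leader \<psi>1 \<psi>2 k \<phi>1 \<phi>2 \<gamma>1 (R \<gamma>1))) \<and>
          (\<forall>x\<in>X_set G k. ctl \<psi>2 k x = R (ctl \<psi>1 k) x)))"

end


subsection \<open>Strong time consistency\<close>

text \<open>The subgame starting at \<open>(k, x)\<close> and truncated strategies, with periods renumbered from \<open>0\<close>.\<close>

definition subgame ::
    "('n::finite, 'm1::finite, 'm2::finite, 's1::finite, 's2::finite, 'c1::finite, 'c2::finite) cnzdg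
     \<Rightarrow> nat \<Rightarrow> real^'n \<Rightarrow> ('n, 'm1, 'm2, 's1, 's2, 'c1, 'c2) cnzdg" where
  "subgame G k x = \<lparr>hor = hor G - k, init = x, dyn = (\<lambda>j. dyn G (k + j)),
     con1 = (\<lambda>j. con1 G (k + j)), con2 = (\<lambda>j. con2 G (k + j)),
     cost = (\<lambda>i j. cost G i (k + j)), term_cost = term_cost G\<rparr>"

definition truncation ::
    "nat \<Rightarrow> ('n::finite, 'm::finite, 's::finite) strategy \<Rightarrow> ('n, 'm, 's) strategy" where
  "truncation k \<psi> = \<lparr>ctl = (\<lambda>j. ctl \<psi> (k + j)), aux = (\<lambda>j. aux \<psi> (k + j))\<rparr>"

definition strongly_time_consistent ::
    "('n::finite, 'm1::finite, 'm2::finite, 's1::finite, 's2::finite, 'c1::finite, 'c2::finite) cnzdg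
     \<Rightarrow> ('n, 'm1, 's1) strategy \<Rightarrow> ('n, 'm2, 's2) strategy \<Rightarrow> bool" where
  "strongly_time_consistent G \<psi>1 \<psi>2 \<longleftrightarrow>
    (\<forall>k\<le>hor G. \<forall>x\<in>X_set G k.
       FSN_solution (subgame G k x) (truncation k \<psi>1) (truncation k \<psi>2))"


subsection \<open>The parametric complementarity problem and the recursion\<close>

definition pseudo_grad ::
    "(player \<Rightarrow> (real^'s1) \<times> (real^'s2) \<Rightarrow> real) \<Rightarrow> (real^'s1) \<times> (real^'s2) \<Rightarrow>
     (real^'s1) \<times> (real^'s2)" where
  "pseudo_grad F v = (grad (\<lambda>w. F Leader (w, snd v)) (fst v),
                      grad (\<lambda>w. F Follower (fst v, w)) (snd v))"

definition jac_con1 ::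
    "('n::finite, 'm1::finite, 'm2::finite, 's1::finite, 's2::finite, 'c1::finite, 'c2::finite) cnzdg
     \<Rightarrow> nat \<Rightarrow> real^'n \<Rightarrow> (real^'s1) \<times> (real^'s2) \<Rightarrow> real^'s1^'c1" where
  "jac_con1 G k x v = jacobian (\<lambda>w. con1 G k x (w, snd v)) (at (fst v))"

definition jac_con2 ::
    "('n::finite, 'm1::finite, 'm2::finite, 's1::finite, 's2::finite, 'c1::finite, 'c2::finite) cnzdg
     \<Rightarrow> nat \<Rightarrow> real^'n \<Rightarrow> (real^'s1) \<times> (real^'s2) \<Rightarrow> real^'s2^'c2" where
  "jac_con2 G k x v = jacobian (\<lambda>w. con2 G k x (fst v, w)) (at (snd v))"

text \<open>\<open>gv i k x v\<close> is the part of the stage cost depending on \<open>v\<close>.\<close>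

definition grad_L ::
    "('n::finite, 'm1::finite, 'm2::finite, 's1::finite, 's2::finite, 'c1::finite, 'c2::finite) cnzdg
     \<Rightarrow> (player \<Rightarrow> nat \<Rightarrow> real^'n \<Rightarrow> (real^'s1) \<times> (real^'s2) \<Rightarrow> real)
     \<Rightarrow> nat \<Rightarrow> real^'n \<Rightarrow> (real^'s1) \<times> (real^'s2) \<Rightarrow> (real^'c1) \<times> (real^'c2)
     \<Rightarrow> (real^'s1) \<times> (real^'s2)" where
  "grad_L G gv k x v \<mu> = pseudo_grad (\<lambda>i. gv i k x) v -
     (transpose (jac_con1 G k x v) *v fst \<mu>, transpose (jac_con2 G k x v) *v snd \<mu>)"

definition SOL_pCP ::
    "('n::finite, 'm1::finite, 'm2::finite, 's1::finite, 's2::finite, 'c1::finite, 'c2::finite) cnzdg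
     \<Rightarrow> (player \<Rightarrow> nat \<Rightarrow> real^'n \<Rightarrow> (real^'s1) \<times> (real^'s2) \<Rightarrow> real)
     \<Rightarrow> nat \<Rightarrow> real^'n \<Rightarrow> (((real^'s1) \<times> (real^'s2)) \<times> ((real^'c1) \<times> (real^'c2))) set" where
  "SOL_pCP G gv k x = {(v, \<mu>).
     complementary (grad_L G gv k x v \<mu>, (con1 G k x v, con2 G k x v)) (v, \<mu>)}"

text \<open>Minimisation over a set \<open>S\<close> of maps, at every state in \<open>X\<close>.\<close>

definition statewise_argmin ::
    "'a set \<Rightarrow> ('a \<Rightarrow> 'b) set \<Rightarrow> (('a \<Rightarrow> 'b) \<Rightarrow> 'a \<Rightarrow> real) \<Rightarrow> ('a \<Rightarrow> 'b) set" where
  "statewise_argmin X S F = {\<gamma>\<in>S. \<forall>\<eta>\<in>S. \<forall>x\<in>X. F \<gamma> x \<le> F \<eta> x}"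

end

(*
  Admissible maps stay admissible when changed at a single state, and every reachable state is
  reached by admissible upstream strategies.  The FSN conditions, stated for total costs over all
  maps, are therefore equivalent to conditions at each reachable state on the stage cost plus the
  cost-to-go.  For the strategies of the recursion the cost-to-go is W.  The third stage is a Nash
  equilibrium because the complementarity conditions are sufficient for optimality, the pseudogradient
  being strictly monotone; strict convexity turns the follower's optimal map into the strict statewise
  minimizer.  For time consistency, an admissible map of a subgame lives on a smaller reachable set
  and has to be extended measurably to the whole one.  This works since reachable sets are countable
  unions of compact sets, hence Borel.
*)

theory Submission
  imports Defs
begin

section \<open>Sufficiency of the complementarity conditions\<close>

text \<open>The follower's response is an operator on whole leader maps, and measurability of a
  response is not evident from minimization at separate states. Hence only the costs are localized;
  the maps and the operator \<open>R\<close> stay global objects. Changing a map at one state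
  requires an admissible pair to start from. The controls of the solution itself serve as this
  background, so their joint admissibility has to be known before anything is localized.

  Time consistency is claimed for an arbitrary FSN solution, which need not come from
  \<open>W\<close>. It is deduced from the equivalence alone: pass to the statewise form, transfer
  it to the subgame, pass back. Borel sets are not stable under continuous images, so reachable sets
  are controlled through a smaller class that is.\<close>

lemma frechet_derivative_grad:
  fixes F :: "real^'d::finite \<Rightarrow> real"
  assumes "F differentiable at v"
  shows "(F has_derivative (\<lambda>h. grad F v \<bullet> h)) (at v)"
proof -
  let ?D = "frechet_derivative F (at v)"
  have D: "(F has_derivative ?D) (at v)"
    using assms frechet_derivative_works by blast
  then interpret linear ?D
    by (rule has_derivative_linear)
  have "?D h = grad F v \<bullet> h" for h
  proof -
    have "?D h = ?D (\<Sum>j\<in>UNIV. (h $ j) *\<^sub>R axis j 1)"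
      by (simp add: basis_expansion scalar_mult_eq_scaleR[symmetric])
    also have "\<dots> = (\<Sum>j\<in>UNIV. h $ j * ?D (axis j 1))"
      by (simp add: sum scale)
    also have "\<dots> = grad F v \<bullet> h"
      by (simp add: grad_def inner_vec_def mult.commute)
    finally show ?thesis .
  qed
  then have "?D = (\<lambda>h. grad F v \<bullet> h)" by blast
  then show ?thesis using D by simp
qed

text \<open>The mean value theorem on the segment from \<open>v\<close> to \<open>w\<close> produces
  the gradient at an intermediate point, and monotonicity bounds its slope along
  \<open>w - v\<close> below by the slope at \<open>v\<close>. Diagonal strict convexity delivers
  exactly such monotonicity for each player.\<close>

lemma monotone_grad_tangent_below:
  fixes F :: "real^'d::finite \<Rightarrow> real"
  assumes diff: "\<And>z. F differentiable at z"
    and mono: "\<And>a b. 0 \<le> (a - b) \<bullet> (grad F a - grad F b)"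
  shows "F v + grad F v \<bullet> (w - v) \<le> F w"
proof -
  define \<phi> where "\<phi> t = F (v + t *\<^sub>R (w - v))" for t :: real
  have der: "(\<phi> has_real_derivative grad F (v + t *\<^sub>R (w - v)) \<bullet> (w - v)) (at t)" for t
  proof -
    have "((\<lambda>t. v + t *\<^sub>R (w - v)) has_derivative (\<lambda>h. h *\<^sub>R (w - v))) (at t)"
      by (auto intro!: derivative_eq_intros)
    from diff_chain_at[OF this frechet_derivative_grad[OF diff]]
    show ?thesis
      by (simp add: \<phi>_def[abs_def] has_field_derivative_def o_def mult_commute_abs)
  qed
  obtain z where z: "0 < z" "z < 1"
    and "\<phi> 1 - \<phi> 0 = (1 - 0) * (grad F (v + z *\<^sub>R (w - v)) \<bullet> (w - v))"
    using MVT2[of 0 1 \<phi> "\<lambda>t. grad F (v + t *\<^sub>R (w - v)) \<bullet> (w - v)"] der by auto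
  then have eq: "F w - F v = grad F (v + z *\<^sub>R (w - v)) \<bullet> (w - v)"
    by (simp add: \<phi>_def)
  have "0 \<le> z * ((w - v) \<bullet> (grad F (v + z *\<^sub>R (w - v)) - grad F v))"
    using mono[of "v + z *\<^sub>R (w - v)" v] by simp
  then have "0 \<le> (w - v) \<bullet> (grad F (v + z *\<^sub>R (w - v)) - grad F v)"
    using z by (simp add: zero_le_mult_iff)
  then show ?thesis
    using eq by (simp add: inner_diff_right inner_commute)
qed

text \<open>A negative directional derivative would push \<open>h\<close> below zero immediately
  after leaving \<open>v\<close> in direction \<open>d\<close>.\<close>

lemma derivative_nonneg_at_active:
  fixes h :: "'a::real_normed_vector \<Rightarrow> real"
  assumes "(h has_derivative h') (at v)" and "h v = 0"
    and nonneg: "\<And>t. 0 < t \<Longrightarrow> t < 1 \<Longrightarrow> 0 \<le> h (v + t *\<^sub>R d)"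
  shows "0 \<le> h' d"
proof (rule ccontr)
  assume neg: "\<not> 0 \<le> h' d"
  have lin: "linear h'" using assms(1) has_derivative_linear by blast
  have "((\<lambda>t. v + t *\<^sub>R d) has_derivative (\<lambda>s. s *\<^sub>R d)) (at 0)"
    by (auto intro!: derivative_eq_intros)
  moreover have "(h has_derivative h') (at (v + 0 *\<^sub>R d))" using assms(1) by simp
  ultimately have "((\<lambda>t. h (v + t *\<^sub>R d)) has_derivative (\<lambda>s. h' (s *\<^sub>R d))) (at 0)"
    using diff_chain_at[of "\<lambda>t. v + t *\<^sub>R d" _ 0 h h'] by (simp add: o_def)
  then have "((\<lambda>t. h (v + t *\<^sub>R d)) has_real_derivative h' d) (at 0)"
    using lin by (simp add: has_field_derivative_def linear_cmul mult_commute_abs)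
  then obtain e where e: "e > 0" "\<And>t. 0 < t \<Longrightarrow> t < e \<Longrightarrow> h (v + t *\<^sub>R d) < 0"
    using DERIV_neg_dec_right[of "\<lambda>t. h (v + t *\<^sub>R d)" "h' d" 0] neg \<open>h v = 0\<close> by auto
  define t where "t = min e 1 / 2"
  have "0 < t" "t < e" "t < 1" using e(1) by (auto simp: t_def)
  then show False using e(2)[of t] nonneg[of t] by simp
qed

text \<open>
  The constraint functions are not assumed concave.  Convexity of the feasible set alone makes the
  derivative of each active constraint nonnegative in feasible directions.
\<close>

lemma complementarity_sufficient:
  fixes F :: "real^'s::finite \<Rightarrow> real" and h :: "real^'s \<Rightarrow> real^'c::finite"
  assumes diff: "\<And>z. F differentiable at z"
    and mono: "\<And>a b. 0 \<le> (a - b) \<bullet> (grad F a - grad F b)"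
    and hdiff: "h differentiable at v"
    and S: "convex S" "v \<in> S" "w \<in> S" "\<And>z. z \<in> S \<Longrightarrow> 0 \<le> h z" "0 \<le> w"
    and L: "0 \<le> grad F v - transpose (jacobian h (at v)) *v \<mu>"
      "(grad F v - transpose (jacobian h (at v)) *v \<mu>) \<bullet> v = 0"
    and \<mu>: "0 \<le> \<mu>" "h v \<bullet> \<mu> = 0"
  shows "F v \<le> F w"
proof -
  let ?J = "jacobian h (at v)" and ?d = "w - v"
  let ?l = "grad F v - transpose ?J *v \<mu>"
  have hd: "(h has_derivative (\<lambda>y. ?J *v y)) (at v)"
    using hdiff jacobian_works by blast
  have prod0: "h v $ j * \<mu> $ j = 0" for j
  proof -
    have "(\<Sum>j\<in>UNIV. h v $ j * \<mu> $ j) = 0" using \<mu>(2) by (simp add: inner_vec_def)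
    moreover have "0 \<le> h v $ j * \<mu> $ j" for j
      using S(4)[OF S(2)] \<mu>(1) by (simp add: less_eq_vec_def)
    ultimately show ?thesis by (simp add: sum_nonneg_eq_0_iff)
  qed
  \<comment> \<open>Inactive constraints have multiplier zero; for active ones the segment from
    \<open>v\<close> to \<open>w\<close> stays in \<open>S\<close>, so the derivative along it is
    nonnegative.\<close>
  have summand: "0 \<le> \<mu> $ j * (?J *v ?d) $ j" for j
  proof (cases "h v $ j = 0")
    case True
    have "((\<lambda>y. h y $ j) has_derivative (\<lambda>y. (?J *v y) $ j)) (at v)"
      using hd by (rule has_derivative_compose[OF _ bounded_linear.has_derivative[OF bounded_linear_vec_nth
            has_derivative_ident], simplified])
    moreover have "0 \<le> h (v + t *\<^sub>R ?d) $ j" if "0 < t" "t < 1" for t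
    proof -
      have "v + t *\<^sub>R ?d = (1 - t) *\<^sub>R v + t *\<^sub>R w" by (simp add: algebra_simps)
      then have "v + t *\<^sub>R ?d \<in> S"
        using S(1,2,3) that by (simp add: convex_alt)
      then show ?thesis using S(4) by (auto simp: less_eq_vec_def)
    qed
    ultimately have "0 \<le> (?J *v ?d) $ j"
      using derivative_nonneg_at_active[of "\<lambda>y. h y $ j" "\<lambda>y. (?J *v y) $ j" v ?d] True by simp
    then show ?thesis using \<mu>(1) by (simp add: less_eq_vec_def)
  next
    case False
    then show ?thesis using prod0[of j] by simp
  qed
  \<comment> \<open>\<open>grad F v\<close> is \<open>?l\<close> plus the multiplier term, and both
    pair nonnegatively with \<open>w - v\<close>: the multiplier term by \<open>summand\<close>, and
    \<open>?l\<close> because it is orthogonal to \<open>v\<close> while \<open>w\<close> is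
    nonnegative.\<close>
  have "(transpose ?J *v \<mu>) \<bullet> ?d = \<mu> \<bullet> (?J *v ?d)"
    by (simp add: dot_lmul_matrix transpose_matrix_vector)
  also have "\<dots> \<ge> 0" using summand by (auto simp: inner_vec_def intro!: sum_nonneg)
  finally have "0 \<le> (transpose ?J *v \<mu>) \<bullet> ?d" .
  moreover have "0 \<le> ?l \<bullet> ?d"
  proof -
    have "0 \<le> ?l \<bullet> w"
      using L(1) S(5) by (auto simp: inner_vec_def less_eq_vec_def intro!: sum_nonneg mult_nonneg_nonneg)
    then show ?thesis using L(2) by (simp only: inner_diff_right)
  qed
  ultimately have "0 \<le> grad F v \<bullet> ?d" by (simp add: inner_diff_left)
  then show ?thesis using monotone_grad_tangent_below[OF diff mono, of v w] by linarith
qed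

lemma continuously_differentiable_imp_continuous:
  assumes "continuously_differentiable f"
  shows "continuous_on UNIV f"
  using assms has_derivative_continuous
  by (force simp: continuously_differentiable_def continuous_on_eq_continuous_at)

lemma continuously_differentiable_imp_differentiable:
  "continuously_differentiable f \<Longrightarrow> f differentiable at z"
  by (auto simp: continuously_differentiable_def differentiable_def)

section \<open>Statewise form of the solution concept\<close>

lemma measurable_restrict_fun_upd:
  assumes "f \<in> borel_measurable (restrict_space borel X)"
  shows "f(x := a) \<in> borel_measurable (restrict_space (borel :: 'a::t1_space measure) X)"
proof -
  have "f(x := a) = (\<lambda>y. if y = x then a else f y)" by auto
  moreover have "{y \<in> space (restrict_space borel X). y = x} = X \<inter> {x}"
    by (auto simp: space_restrict_space)
  ultimately show ?thesis using assms
    by (auto intro!: measurable_If simp: sets_restrict_space)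
qed

text \<open>The localization device: one state can be given any admissible action. Points are
  closed, so measurability survives, and joint admissibility at the other states is
  untouched.\<close>

lemma Gamma_set_upd:
  assumes "(\<gamma>1, \<gamma>2) \<in> Gamma_set G k" and "(a, b) \<in> U_set G k x"
  shows "(\<gamma>1(x := a), \<gamma>2(x := b)) \<in> Gamma_set G k"
  using assms by (auto simp: Gamma_set_def measurable_restrict_fun_upd)

text \<open>Measurability refers to the restricted space, so only values at reachable states matter.
  This is needed because the follower's control is tied to the response only there.\<close>

lemma Gamma_set_cong:
  assumes "(\<gamma>1, \<gamma>2) \<in> Gamma_set G k" and eq: "\<And>x. x \<in> X_set G k \<Longrightarrow> \<gamma>2' x = \<gamma>2 x"
  shows "(\<gamma>1, \<gamma>2') \<in> Gamma_set G k"
proof -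
  have "\<gamma>2' \<in> borel_measurable (restrict_space borel (X_set G k)) \<longleftrightarrow>
      \<gamma>2 \<in> borel_measurable (restrict_space borel (X_set G k))"
    using eq by (intro measurable_cong) (simp add: space_restrict_space)
  then show ?thesis using assms by (simp add: Gamma_set_def)
qed

lemma traj_cong:
  assumes "\<And>j. j < k \<Longrightarrow> ctl \<phi>1 j = ctl \<psi>1 j" "\<And>j. j < k \<Longrightarrow> ctl \<phi>2 j = ctl \<psi>2 j"
  shows "traj G \<phi>1 \<phi>2 k = traj G \<psi>1 \<psi>2 k"
  using assms by (induction k) auto

lemma traj_in_X_set:
  assumes "upstream_admissible G k \<phi>1 \<phi>2"
  shows "traj G \<phi>1 \<phi>2 k \<in> X_set G k"
  using assms
proof (induction k)
  case (Suc k)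
  then have "upstream_admissible G k \<phi>1 \<phi>2" "(ctl \<phi>1 k, ctl \<phi>2 k) \<in> Gamma_set G k"
    by (auto simp: upstream_admissible_def)
  moreover from this have "traj G \<phi>1 \<phi>2 k \<in> X_set G k" using Suc.IH by blast
  ultimately have "(ctl \<phi>1 k (traj G \<phi>1 \<phi>2 k), ctl \<phi>2 k (traj G \<phi>1 \<phi>2 k)) \<in> U_set G k (traj G \<phi>1 \<phi>2 k)"
    by (simp add: Gamma_set_def)
  with \<open>traj G \<phi>1 \<phi>2 k \<in> X_set G k\<close> show ?case by auto
qed simp

text \<open>Reachability speaks of sequences of actions, upstream strategies of measurable maps. The
  background maps \<open>\<alpha>\<close>, \<open>\<beta>\<close> bridge the gap: in each period
  they are changed only at the state being visited.\<close>

lemma reachable_by_admissible: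
  assumes "\<And>j. j < k \<Longrightarrow> (\<alpha> j, \<beta> j) \<in> Gamma_set G j"
    and "\<And>j x. j < k \<Longrightarrow> x \<in> X_set G j \<Longrightarrow> V_set G j x \<noteq> {}"
    and "x \<in> X_set G k"
  obtains \<phi>1 \<phi>2 where "upstream_admissible G k \<phi>1 \<phi>2" "traj G \<phi>1 \<phi>2 k = x"
proof -
  have "\<exists>\<phi>1 \<phi>2. upstream_admissible G k \<phi>1 \<phi>2 \<and> traj G \<phi>1 \<phi>2 k = x"
    using assms
  proof (induction k arbitrary: x)
    case 0
    then show ?case by (auto simp: upstream_admissible_def)
  next
    case (Suc k)
    from Suc.prems(3) obtain y a b where y: "y \<in> X_set G k" "(a, b) \<in> U_set G k y"
      "x = dyn G k y (a, b)" by auto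
    obtain \<phi>1 \<phi>2 where \<phi>: "upstream_admissible G k \<phi>1 \<phi>2" "traj G \<phi>1 \<phi>2 k = y"
      using Suc.IH[OF _ _ y(1)] Suc.prems(1,2) less_SucI by blast
    \<comment> \<open>Plain choice suffices, since upstream \<open>aux\<close> decisions must be
      feasible but carry no measurability condition.\<close>
    define v where "v z = (SOME v. v \<in> V_set G k z)" for z
    have v: "v z \<in> V_set G k z" if "z \<in> X_set G k" for z
      using Suc.prems(2)[of k z] that by (auto simp: v_def some_in_eq)
    define \<phi>1' where "\<phi>1' = \<lparr>ctl = (ctl \<phi>1)(k := (\<alpha> k)(y := a)), aux = (aux \<phi>1)(k := fst \<circ> v)\<rparr>"
    define \<phi>2' where "\<phi>2' = \<lparr>ctl = (ctl \<phi>2)(k := (\<beta> k)(y := b)), aux = (aux \<phi>2)(k := snd \<circ> v)\<rparr>"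
    have "upstream_admissible G (Suc k) \<phi>1' \<phi>2'"
      using \<phi>(1) Suc.prems(1) v Gamma_set_upd[OF _ y(2)]
      by (auto simp: upstream_admissible_def \<phi>1'_def \<phi>2'_def less_Suc_eq)
    moreover have "traj G \<phi>1' \<phi>2' k = y"
      unfolding \<phi>(2)[symmetric] by (rule traj_cong) (auto simp: \<phi>1'_def \<phi>2'_def)
    then have "traj G \<phi>1' \<phi>2' (Suc k) = x" by (simp add: y(3)) (simp add: \<phi>1'_def \<phi>2'_def)
    ultimately show ?case by blast
  qed
  then show thesis using that by blast
qed

section \<open>The third-stage condition and the cost to go\<close>

definition stage_payoff where
  "stage_payoff G i k x u v = (if k < hor G then cost G i k x u v else term_cost G i x v)"

text \<open>Adding to each player's cost a term free of the decisions leaves this condition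
  unchanged, so it passes between \<open>stage_payoff\<close> and \<open>gv\<close>.\<close>

definition nash_at where
  "nash_at G k x c v1 v2 \<longleftrightarrow> (v1, v2) \<in> V_set G k x \<and>
    (\<forall>w\<in>V1_set G k x v2. c Leader (v1, v2) \<le> (c Leader (w, v2) :: real)) \<and>
    (\<forall>w\<in>V2_set G k x v1. c Follower (v1, v2) \<le> c Follower (v1, w))"

lemma total_cost_eq_sum:
  "total_cost G i \<psi>1 \<psi>2 = (\<Sum>k\<le>hor G. stage_payoff G i k (traj G \<psi>1 \<psi>2 k)
     (ctl \<psi>1 k (traj G \<psi>1 \<psi>2 k), ctl \<psi>2 k (traj G \<psi>1 \<psi>2 k))
     (aux \<psi>1 k (traj G \<psi>1 \<psi>2 k), aux \<psi>2 k (traj G \<psi>1 \<psi>2 k)))"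
  unfolding total_cost_def Let_def lessThan_Suc_atMost[symmetric] sum.lessThan_Suc
  by (simp add: stage_payoff_def)

text \<open>The decisions in \<open>aux\<close> do not enter the dynamics: changing one at period
  \<open>k\<close> keeps the trajectory and alters a single summand of the total cost.\<close>

lemma third_stage_nash_iff:
  fixes G :: "('n::finite, 'm1::finite, 'm2::finite, 's1::finite, 's2::finite,
      'c1::finite, 'c2::finite) cnzdg"
    and \<psi>1 :: "('n, 'm1, 's1) strategy" and \<psi>2 :: "('n, 'm2, 's2) strategy"
  assumes k: "k \<le> hor G"
  defines "x \<equiv> traj G \<psi>1 \<psi>2 k"
  shows "third_stage_nash G k \<psi>1 \<psi>2 \<longleftrightarrow>
    nash_at G k x (\<lambda>i. stage_payoff G i k x (ctl \<psi>1 k x, ctl \<psi>2 k x)) (aux \<psi>1 k x) (aux \<psi>2 k x)"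
proof -
  define u where "u = (ctl \<psi>1 k x, ctl \<psi>2 k x)"
  have ctl_set_aux: "ctl (set_aux k w \<psi>) = ctl \<psi>" for w \<psi>
    by (simp add: set_aux_def)
  have traj1: "traj G (set_aux k w \<psi>1) \<psi>2 = traj G \<psi>1 \<psi>2"
    and traj2: "traj G \<psi>1 (set_aux k w' \<psi>2) = traj G \<psi>1 \<psi>2" for w w'
    by (auto intro!: ext traj_cong simp: ctl_set_aux)
  \<comment> \<open>The cost of all other periods, common to both sides of every inequality.\<close>
  define C where "C i = (\<Sum>j\<in>{..hor G} - {k}. stage_payoff G i j (traj G \<psi>1 \<psi>2 j)
     (ctl \<psi>1 j (traj G \<psi>1 \<psi>2 j), ctl \<psi>2 j (traj G \<psi>1 \<psi>2 j))
     (aux \<psi>1 j (traj G \<psi>1 \<psi>2 j), aux \<psi>2 j (traj G \<psi>1 \<psi>2 j)))" for i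
  have rem: "(\<Sum>j\<le>hor G. f j) = f k + (\<Sum>j\<in>{..hor G} - {k}. f j)" for f :: "nat \<Rightarrow> real"
    using k by (intro sum.remove) auto
  have t0: "total_cost G i \<psi>1 \<psi>2 = stage_payoff G i k x u (aux \<psi>1 k x, aux \<psi>2 k x) + C i" for i
    unfolding total_cost_eq_sum rem C_def x_def u_def by (rule refl)
  have t1: "total_cost G i (set_aux k w \<psi>1) \<psi>2 = stage_payoff G i k x u (w, aux \<psi>2 k x) + C i" for i w
    unfolding total_cost_eq_sum traj1 ctl_set_aux rem C_def x_def u_def
    by (intro arg_cong2[of _ _ _ _ "(+)"] sum.cong refl) (auto simp: set_aux_def)
  have t2: "total_cost G i \<psi>1 (set_aux k w \<psi>2) = stage_payoff G i k x u (aux \<psi>1 k x, w) + C i" for i w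
    unfolding total_cost_eq_sum traj2 ctl_set_aux rem C_def x_def u_def
    by (intro arg_cong2[of _ _ _ _ "(+)"] sum.cong refl) (auto simp: set_aux_def)
  show ?thesis
    unfolding third_stage_nash_def Let_def nash_at_def x_def[symmetric] u_def[symmetric] t0 t1 t2
    by simp
qed

text \<open>The numeric argument counts the remaining periods.\<close>

primrec cost_to_go where
  "cost_to_go G i \<psi>1 \<psi>2 0 x = term_cost G i x (aux \<psi>1 (hor G) x, aux \<psi>2 (hor G) x)"
| "cost_to_go G i \<psi>1 \<psi>2 (Suc n) x =
    cost G i (hor G - Suc n) x (ctl \<psi>1 (hor G - Suc n) x, ctl \<psi>2 (hor G - Suc n) x)
      (aux \<psi>1 (hor G - Suc n) x, aux \<psi>2 (hor G - Suc n) x)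
    + cost_to_go G i \<psi>1 \<psi>2 n
        (dyn G (hor G - Suc n) x (ctl \<psi>1 (hor G - Suc n) x, ctl \<psi>2 (hor G - Suc n) x))"

text \<open>The state-action value (Q-function) of the strategies: only the action at
  \<open>k\<close> is free, while the decisions at \<open>k\<close> and all later play follow
  \<open>\<psi>1\<close>, \<open>\<psi>2\<close>.\<close>

definition action_cost where
  "action_cost G i \<psi>1 \<psi>2 k x u = cost G i k x u (aux \<psi>1 k x, aux \<psi>2 k x)
    + cost_to_go G i \<psi>1 \<psi>2 (hor G - Suc k) (dyn G k x u)"

lemma cost_to_go_unfold:
  assumes "k < hor G"
  shows "cost_to_go G i \<psi>1 \<psi>2 (hor G - k) x = action_cost G i \<psi>1 \<psi>2 k x (ctl \<psi>1 k x, ctl \<psi>2 k x)"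
proof -
  have "hor G - k = Suc (hor G - Suc k)" "hor G - Suc (hor G - Suc k) = k" using assms by auto
  then show ?thesis by (simp add: action_cost_def)
qed

lemma cost_to_go_cong:
  assumes "n \<le> hor G"
    and "\<And>j. hor G - n \<le> j \<Longrightarrow> ctl \<phi>1 j = ctl \<psi>1 j \<and> ctl \<phi>2 j = ctl \<psi>2 j
      \<and> aux \<phi>1 j = aux \<psi>1 j \<and> aux \<phi>2 j = aux \<psi>2 j"
  shows "cost_to_go G i \<phi>1 \<phi>2 n x = cost_to_go G i \<psi>1 \<psi>2 n x"
  using assms by (induction n arbitrary: x) auto

lemma total_cost_from:
  assumes "k \<le> hor G"
  shows "total_cost G i \<psi>1 \<psi>2 =
    (\<Sum>j<k. cost G i j (traj G \<psi>1 \<psi>2 j) (ctl \<psi>1 j (traj G \<psi>1 \<psi>2 j), ctl \<psi>2 j (traj G \<psi>1 \<psi>2 j))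
       (aux \<psi>1 j (traj G \<psi>1 \<psi>2 j), aux \<psi>2 j (traj G \<psi>1 \<psi>2 j)))
    + cost_to_go G i \<psi>1 \<psi>2 (hor G - k) (traj G \<psi>1 \<psi>2 k)"
  using assms
proof (induction rule: inc_induct)
  case base
  then show ?case by (simp add: total_cost_def Let_def)
next
  case (step k)
  then show ?case by (simp add: cost_to_go_unfold action_cost_def)
qed

text \<open>The sum depends on upstream play only and cancels in every comparison at period
  \<open>k\<close>. What remains involves the maps only through their actions at the state
  reached.\<close>

lemma stage_cost_eq:
  fixes G :: "('n::finite, 'm1::finite, 'm2::finite, 's1::finite, 's2::finite,
      'c1::finite, 'c2::finite) cnzdg"
  assumes k: "k < hor G"
  shows "stage_cost G i \<psi>1 \<psi>2 k \<phi>1 \<phi>2 \<gamma>1 \<gamma>2 =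
    (\<Sum>j<k. cost G i j (traj G \<phi>1 \<phi>2 j) (ctl \<phi>1 j (traj G \<phi>1 \<phi>2 j), ctl \<phi>2 j (traj G \<phi>1 \<phi>2 j))
       (aux \<phi>1 j (traj G \<phi>1 \<phi>2 j), aux \<phi>2 j (traj G \<phi>1 \<phi>2 j)))
    + action_cost G i \<psi>1 \<psi>2 k (traj G \<phi>1 \<phi>2 k) (\<gamma>1 (traj G \<phi>1 \<phi>2 k), \<gamma>2 (traj G \<phi>1 \<phi>2 k))"
proof -
  define \<chi>1 where "\<chi>1 = set_ctl k \<gamma>1 (splice k \<phi>1 \<psi>1)"
  define \<chi>2 where "\<chi>2 = set_ctl k \<gamma>2 (splice k \<phi>2 \<psi>2)"
  note \<chi>_simps = \<chi>1_def \<chi>2_def set_ctl_def splice_def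
  have traj: "traj G \<chi>1 \<chi>2 j = traj G \<phi>1 \<phi>2 j" if "j \<le> k" for j
    using that by (intro traj_cong) (auto simp: \<chi>_simps)
  have down: "cost_to_go G i \<chi>1 \<chi>2 (hor G - Suc k) y = cost_to_go G i \<psi>1 \<psi>2 (hor G - Suc k) y" for y
    using k by (intro cost_to_go_cong) (auto simp: \<chi>_simps)
  have at_k: "ctl \<chi>1 k = \<gamma>1" "ctl \<chi>2 k = \<gamma>2" "aux \<chi>1 k = aux \<psi>1 k" "aux \<chi>2 k = aux \<psi>2 k"
    by (simp_all add: \<chi>_simps)
  have up: "ctl \<chi>1 j = ctl \<phi>1 j" "ctl \<chi>2 j = ctl \<phi>2 j" "aux \<chi>1 j = aux \<phi>1 j" "aux \<chi>2 j = aux \<phi>2 j"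
    if "j < k" for j using that by (simp_all add: \<chi>_simps)
  show ?thesis
    unfolding stage_cost_def \<chi>1_def[symmetric] \<chi>2_def[symmetric] total_cost_from[OF less_imp_le[OF k]]
      cost_to_go_unfold[OF k] action_cost_def down at_k
    by (simp add: traj up)
qed

text \<open>
  The follower's response is required to be the strict minimizer at each state.  This encodes
  uniqueness of the response map: a second minimizer at one state would give a second response map.
\<close>

definition statewise_stackelberg where
  "statewise_stackelberg G \<psi>1 \<psi>2 k R \<longleftrightarrow>
    (\<forall>\<gamma>1\<in>Gamma1_set G k. R \<gamma>1 \<in> Gamma2_set G k \<gamma>1) \<and>
    (\<forall>\<gamma>1\<in>Gamma1_set G k. \<forall>x\<in>X_set G k. \<forall>u2\<in>U2_set G k x (\<gamma>1 x). u2 \<noteq> R \<gamma>1 x \<longrightarrow>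
       action_cost G Follower \<psi>1 \<psi>2 k x (\<gamma>1 x, R \<gamma>1 x)
         < action_cost G Follower \<psi>1 \<psi>2 k x (\<gamma>1 x, u2)) \<and>
    (\<forall>\<gamma>1\<in>Gamma1_set G k. \<forall>x\<in>X_set G k.
       action_cost G Leader \<psi>1 \<psi>2 k x (ctl \<psi>1 k x, R (ctl \<psi>1 k) x)
         \<le> action_cost G Leader \<psi>1 \<psi>2 k x (\<gamma>1 x, R \<gamma>1 x)) \<and>
    (\<forall>x\<in>X_set G k. ctl \<psi>2 k x = R (ctl \<psi>1 k) x)"

text \<open>At the horizon no action is taken: \<open>u\<close> is then unrestricted and
  \<open>stage_payoff\<close> ignores it. Joint admissibility of the controls is kept as a clause
  because they are the background maps for reaching states.\<close>

definition statewise_FSN where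
  "statewise_FSN G \<psi>1 \<psi>2 \<longleftrightarrow>
    (\<forall>k\<le>hor G. \<forall>x\<in>X_set G k. \<forall>u. (k < hor G \<longrightarrow> u \<in> U_set G k x) \<longrightarrow>
       nash_at G k x (\<lambda>i. stage_payoff G i k x u) (aux \<psi>1 k x) (aux \<psi>2 k x)) \<and>
    (\<forall>k<hor G. (ctl \<psi>1 k, ctl \<psi>2 k) \<in> Gamma_set G k \<and>
       (\<exists>R. statewise_stackelberg G \<psi>1 \<psi>2 k R))"

section \<open>Equivalence of the FSN conditions with their statewise form\<close>

lemma third_stage_nash_splice_iff:
  fixes G :: "('n::finite, 'm1::finite, 'm2::finite, 's1::finite, 's2::finite,
      'c1::finite, 'c2::finite) cnzdg"
    and \<phi>1 :: "('n, 'm1, 's1) strategy" and \<phi>2 :: "('n, 'm2, 's2) strategy"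
  assumes k: "k \<le> hor G"
  defines "x \<equiv> traj G \<phi>1 \<phi>2 k"
  shows "third_stage_nash G k (set_ctl k \<gamma>1 (splice k \<phi>1 \<psi>1)) (set_ctl k \<gamma>2 (splice k \<phi>2 \<psi>2)) \<longleftrightarrow>
    nash_at G k x (\<lambda>i. stage_payoff G i k x (\<gamma>1 x, \<gamma>2 x)) (aux \<psi>1 k x) (aux \<psi>2 k x)"
proof -
  have "traj G (set_ctl k \<gamma>1 (splice k \<phi>1 \<psi>1)) (set_ctl k \<gamma>2 (splice k \<phi>2 \<psi>2)) k = x"
    unfolding x_def by (intro traj_cong) (auto simp: set_ctl_def splice_def)
  then show ?thesis
    unfolding third_stage_nash_iff[OF k] by (simp add: set_ctl_def splice_def)
qed

lemma set_ctl_splice: "set_ctl k (ctl \<psi> k) (splice k \<phi> \<psi>) = splice k \<phi> \<psi>"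
  by (auto simp: set_ctl_def splice_def)

lemma nash_at_terminal:
  "nash_at G (hor G) x (\<lambda>i. stage_payoff G i (hor G) x u) v1 v2 \<longleftrightarrow>
    nash_at G (hor G) x (\<lambda>i. stage_payoff G i (hor G) x u') v1 v2"
  by (simp add: stage_payoff_def nash_at_def)

lemma FSN_imp_statewise:
  fixes G :: "('n::finite, 'm1::finite, 'm2::finite, 's1::finite, 's2::finite,
      'c1::finite, 'c2::finite) cnzdg"
  assumes FSN: "FSN_solution G \<psi>1 \<psi>2"
    and V: "\<And>k x. k < hor G \<Longrightarrow> x \<in> X_set G k \<Longrightarrow> V_set G k x \<noteq> {}"
  shows "statewise_FSN G \<psi>1 \<psi>2"
proof -
  have adm: "(ctl \<psi>1 k, ctl \<psi>2 k) \<in> Gamma_set G k" if k: "k < hor G" for k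
  proof -
    from FSN k obtain R where R: "unique_response_map G \<psi>1 \<psi>2 k R" "ctl \<psi>1 k \<in> Gamma1_set G k"
        "\<forall>x\<in>X_set G k. ctl \<psi>2 k x = R (ctl \<psi>1 k) x"
      unfolding FSN_solution_def by blast
    then have "(ctl \<psi>1 k, R (ctl \<psi>1 k)) \<in> Gamma_set G k"
      by (auto simp: unique_response_map_def responses_def Gamma2_set_def)
    with R(3) show ?thesis by (auto intro: Gamma_set_cong)
  qed
  have reach: "\<exists>\<phi>1 \<phi>2. upstream_admissible G k \<phi>1 \<phi>2 \<and> traj G \<phi>1 \<phi>2 k = x"
    if "k \<le> hor G" "x \<in> X_set G k" for k x
    using reachable_by_admissible[of k "ctl \<psi>1" "ctl \<psi>2" G x] that adm V by (metis order_less_le_trans)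
  have nash: "nash_at G k x (\<lambda>i. stage_payoff G i k x u) (aux \<psi>1 k x) (aux \<psi>2 k x)"
    if k: "k \<le> hor G" "x \<in> X_set G k" "k < hor G \<longrightarrow> u \<in> U_set G k x" for k x u
  proof -
    obtain \<phi>1 \<phi>2 where \<phi>: "upstream_admissible G k \<phi>1 \<phi>2" "traj G \<phi>1 \<phi>2 k = x"
      using reach k by blast
    show ?thesis
    proof (cases "k < hor G")
      case True
      obtain a b where u: "u = (a, b)" by fastforce
      \<comment> \<open>The changed maps realize an arbitrary admissible action \<open>u\<close> at
        \<open>x\<close>, the only state at which the condition will be read.\<close>
      then have "((ctl \<psi>1 k)(x := a), (ctl \<psi>2 k)(x := b)) \<in> Gamma_set G k"
        using Gamma_set_upd[OF adm[OF True]] k True by blast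
      then have "third_stage_nash G k (set_ctl k ((ctl \<psi>1 k)(x := a)) (splice k \<phi>1 \<psi>1))
          (set_ctl k ((ctl \<psi>2 k)(x := b)) (splice k \<phi>2 \<psi>2))"
        using FSN True \<phi>(1) unfolding FSN_solution_def by blast
      then show ?thesis
        unfolding third_stage_nash_splice_iff[OF k(1)] \<phi>(2) u by simp
    next
      case False
      then have [simp]: "k = hor G" using k by simp
      have "third_stage_nash G k (splice k \<phi>1 \<psi>1) (splice k \<phi>2 \<psi>2)"
        using FSN \<phi>(1) unfolding FSN_solution_def by simp
      then have "third_stage_nash G k (set_ctl k (ctl \<psi>1 k) (splice k \<phi>1 \<psi>1))
          (set_ctl k (ctl \<psi>2 k) (splice k \<phi>2 \<psi>2))" by (simp only: set_ctl_splice)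
      \<comment> \<open>This gives the condition for the action prescribed by the controls; at the
        horizon the action is a dummy and may be replaced by \<open>u\<close>.\<close>
      then show ?thesis
        unfolding third_stage_nash_splice_iff[OF k(1)] \<phi>(2) using nash_at_terminal by simp blast
    qed
  qed
  have "\<exists>R. statewise_stackelberg G \<psi>1 \<psi>2 k R"
    if k: "k < hor G" for k
  proof -
    from FSN k obtain R where R: "unique_response_map G \<psi>1 \<psi>2 k R"
        "\<forall>\<phi>1 \<phi>2. upstream_admissible G k \<phi>1 \<phi>2 \<longrightarrow> (\<forall>\<gamma>1\<in>Gamma1_set G k.
                stage_cost G Leader \<psi>1 \<psi>2 k \<phi>1 \<phi>2 (ctl \<psi>1 k) (R (ctl \<psi>1 k))
                  \<le> stage_cost G Leader \<psi>1 \<psi>2 k \<phi>1 \<phi>2 \<gamma>1 (R \<gamma>1))"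
        "\<forall>x\<in>X_set G k. ctl \<psi>2 k x = R (ctl \<psi>1 k) x"
      unfolding FSN_solution_def by blast
    have resp: "R \<gamma>1 \<in> Gamma2_set G k \<gamma>1"
      and min: "\<And>\<eta> x. \<eta> \<in> Gamma2_set G k \<gamma>1 \<Longrightarrow> x \<in> X_set G k \<Longrightarrow>
        action_cost G Follower \<psi>1 \<psi>2 k x (\<gamma>1 x, R \<gamma>1 x) \<le> action_cost G Follower \<psi>1 \<psi>2 k x (\<gamma>1 x, \<eta> x)"
      if "\<gamma>1 \<in> Gamma1_set G k" for \<gamma>1
    proof -
      have r: "R \<gamma>1 \<in> responses G \<psi>1 \<psi>2 k \<gamma>1" using R(1) that by (simp add: unique_response_map_def)
      then show "R \<gamma>1 \<in> Gamma2_set G k \<gamma>1" by (simp add: responses_def)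
      fix \<eta> x assume \<eta>: "\<eta> \<in> Gamma2_set G k \<gamma>1" and x: "x \<in> X_set G k"
      obtain \<phi>1 \<phi>2 where \<phi>: "upstream_admissible G k \<phi>1 \<phi>2" "traj G \<phi>1 \<phi>2 k = x"
        using reach[of k x] x k by auto
      with r \<eta> have "stage_cost G Follower \<psi>1 \<psi>2 k \<phi>1 \<phi>2 \<gamma>1 (R \<gamma>1)
          \<le> stage_cost G Follower \<psi>1 \<psi>2 k \<phi>1 \<phi>2 \<gamma>1 \<eta>"
        by (simp add: responses_def)
      then show "action_cost G Follower \<psi>1 \<psi>2 k x (\<gamma>1 x, R \<gamma>1 x)
          \<le> action_cost G Follower \<psi>1 \<psi>2 k x (\<gamma>1 x, \<eta> x)"
        unfolding stage_cost_eq[OF k] \<phi>(2) by simp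
    qed
    have strict: "action_cost G Follower \<psi>1 \<psi>2 k x (\<gamma>1 x, R \<gamma>1 x)
                    < action_cost G Follower \<psi>1 \<psi>2 k x (\<gamma>1 x, u2)"
      if \<gamma>1: "\<gamma>1 \<in> Gamma1_set G k" and x: "x \<in> X_set G k" and u2: "u2 \<in> U2_set G k x (\<gamma>1 x)"
        and ne: "u2 \<noteq> R \<gamma>1 x" for \<gamma>1 x u2
    proof (rule ccontr)
      assume le: "\<not> ?thesis"
      \<comment> \<open>If \<open>u2\<close> were at least as good at \<open>x\<close>, the response
        changed to \<open>u2\<close> at \<open>x\<close> would again be a response, differing from
        \<open>R \<gamma>1\<close> at a reachable state.\<close>
      define \<eta> where "\<eta> = (R \<gamma>1)(x := u2)"
      have "(\<gamma>1(x := \<gamma>1 x), \<eta>) \<in> Gamma_set G k"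
        unfolding \<eta>_def using resp[OF \<gamma>1] u2
        by (intro Gamma_set_upd) (auto simp: Gamma2_set_def U2_set_def)
      then have \<eta>: "\<eta> \<in> Gamma2_set G k \<gamma>1" by (simp add: Gamma2_set_def)
      have \<eta>_min: "action_cost G Follower \<psi>1 \<psi>2 k y (\<gamma>1 y, \<eta> y)
          \<le> action_cost G Follower \<psi>1 \<psi>2 k y (\<gamma>1 y, \<theta> y)"
        if "\<theta> \<in> Gamma2_set G k \<gamma>1" "y \<in> X_set G k" for \<theta> y
        using min[OF \<gamma>1 that] le by (auto simp: \<eta>_def)
      then have "\<eta> \<in> responses G \<psi>1 \<psi>2 k \<gamma>1"
        using \<eta> traj_in_X_set[of G k] by (simp add: responses_def stage_cost_eq[OF k])
      then have "\<eta> x = R \<gamma>1 x" using R(1) \<gamma>1 x by (auto simp: unique_response_map_def)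
      then show False using ne by (simp add: \<eta>_def)
    qed
    have lead: "action_cost G Leader \<psi>1 \<psi>2 k x (ctl \<psi>1 k x, R (ctl \<psi>1 k) x)
                  \<le> action_cost G Leader \<psi>1 \<psi>2 k x (\<gamma>1 x, R \<gamma>1 x)"
      if \<gamma>1: "\<gamma>1 \<in> Gamma1_set G k" and x: "x \<in> X_set G k" for \<gamma>1 x
    proof -
      obtain \<phi>1 \<phi>2 where \<phi>: "upstream_admissible G k \<phi>1 \<phi>2" "traj G \<phi>1 \<phi>2 k = x"
        using reach[of k x] x k by auto
      with R(2) \<gamma>1 have "stage_cost G Leader \<psi>1 \<psi>2 k \<phi>1 \<phi>2 (ctl \<psi>1 k) (R (ctl \<psi>1 k))
                  \<le> stage_cost G Leader \<psi>1 \<psi>2 k \<phi>1 \<phi>2 \<gamma>1 (R \<gamma>1)" by blast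
      then show ?thesis unfolding stage_cost_eq[OF k] \<phi>(2) by simp
    qed
    show ?thesis using resp strict lead R(3) unfolding statewise_stackelberg_def by blast
  qed
  with nash adm show ?thesis unfolding statewise_FSN_def by blast
qed

lemma statewise_imp_FSN:
  fixes G :: "('n::finite, 'm1::finite, 'm2::finite, 's1::finite, 's2::finite,
      'c1::finite, 'c2::finite) cnzdg"
  assumes sw: "statewise_FSN G \<psi>1 \<psi>2"
  shows "FSN_solution G \<psi>1 \<psi>2"
proof -
  have nash: "nash_at G k x (\<lambda>i. stage_payoff G i k x u) (aux \<psi>1 k x) (aux \<psi>2 k x)"
    if "k \<le> hor G" "x \<in> X_set G k" "k < hor G \<Longrightarrow> u \<in> U_set G k x" for k x u
    using sw that unfolding statewise_FSN_def by blast
  have adm: "(ctl \<psi>1 k, ctl \<psi>2 k) \<in> Gamma_set G k" if "k < hor G" for k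
    using sw that unfolding statewise_FSN_def by blast
  \<comment> \<open>The equilibrium pair itself shows nonemptiness; the controls supply the
    admissible action at which to invoke \<open>nash\<close>.\<close>
  have V: "V_set G k x \<noteq> {}" if "k < hor G" "x \<in> X_set G k" for k x
    using nash[of k x "(ctl \<psi>1 k x, ctl \<psi>2 k x)"] adm[OF that(1)] that
    by (auto simp: Gamma_set_def nash_at_def)
  have reach: "\<exists>\<phi>1 \<phi>2. upstream_admissible G k \<phi>1 \<phi>2 \<and> traj G \<phi>1 \<phi>2 k = x"
    if "k \<le> hor G" "x \<in> X_set G k" for k x
    using reachable_by_admissible[of k "ctl \<psi>1" "ctl \<psi>2" G x] that adm V by (metis order_less_le_trans)
  have stage3: "third_stage_nash G k (set_ctl k \<gamma>1 (splice k \<phi>1 \<psi>1)) (set_ctl k \<gamma>2 (splice k \<phi>2 \<psi>2))"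
    if "k \<le> hor G" "upstream_admissible G k \<phi>1 \<phi>2" "k < hor G \<Longrightarrow> (\<gamma>1, \<gamma>2) \<in> Gamma_set G k"
    for k \<phi>1 \<phi>2 \<gamma>1 \<gamma>2
    unfolding third_stage_nash_splice_iff[OF that(1)]
    using that traj_in_X_set[OF that(2)] by (intro nash) (auto simp: Gamma_set_def)
  have terminal: "third_stage_nash G (hor G) (splice (hor G) \<phi>1 \<psi>1) (splice (hor G) \<phi>2 \<psi>2)"
    if "upstream_admissible G (hor G) \<phi>1 \<phi>2" for \<phi>1 \<phi>2
    using stage3[of "hor G" \<phi>1 \<phi>2 "ctl \<psi>1 (hor G)" "ctl \<psi>2 (hor G)"] that by (simp add: set_ctl_splice)
  have stages: "\<exists>R. unique_response_map G \<psi>1 \<psi>2 k R \<and> ctl \<psi>1 k \<in> Gamma1_set G k \<and>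
          (\<forall>\<phi>1 \<phi>2. upstream_admissible G k \<phi>1 \<phi>2 \<longrightarrow>
             (\<forall>\<gamma>1\<in>Gamma1_set G k.
                stage_cost G Leader \<psi>1 \<psi>2 k \<phi>1 \<phi>2 (ctl \<psi>1 k) (R (ctl \<psi>1 k))
                  \<le> stage_cost G Leader \<psi>1 \<psi>2 k \<phi>1 \<phi>2 \<gamma>1 (R \<gamma>1))) \<and>
          (\<forall>x\<in>X_set G k. ctl \<psi>2 k x = R (ctl \<psi>1 k) x)" if k: "k < hor G" for k
  proof -
    from sw k obtain R where "statewise_stackelberg G \<psi>1 \<psi>2 k R"
      unfolding statewise_FSN_def by blast
    then have R: "\<And>\<gamma>1. \<gamma>1\<in>Gamma1_set G k \<Longrightarrow> R \<gamma>1 \<in> Gamma2_set G k \<gamma>1"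
      and strict: "\<And>\<gamma>1 x u2. \<gamma>1\<in>Gamma1_set G k \<Longrightarrow> x\<in>X_set G k \<Longrightarrow> u2\<in>U2_set G k x (\<gamma>1 x) \<Longrightarrow>
               u2 \<noteq> R \<gamma>1 x \<Longrightarrow> action_cost G Follower \<psi>1 \<psi>2 k x (\<gamma>1 x, R \<gamma>1 x)
                    < action_cost G Follower \<psi>1 \<psi>2 k x (\<gamma>1 x, u2)"
      and lead: "\<And>\<gamma>1 x. \<gamma>1\<in>Gamma1_set G k \<Longrightarrow> x\<in>X_set G k \<Longrightarrow>
               action_cost G Leader \<psi>1 \<psi>2 k x (ctl \<psi>1 k x, R (ctl \<psi>1 k) x)
                  \<le> action_cost G Leader \<psi>1 \<psi>2 k x (\<gamma>1 x, R \<gamma>1 x)"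
      and foll: "\<And>x. x\<in>X_set G k \<Longrightarrow> ctl \<psi>2 k x = R (ctl \<psi>1 k) x"
      unfolding statewise_stackelberg_def by blast+
    have U2: "\<eta> x \<in> U2_set G k x (\<gamma>1 x)" if "\<eta> \<in> Gamma2_set G k \<gamma>1" "x \<in> X_set G k" for \<eta> \<gamma>1 x
      using that by (auto simp: Gamma2_set_def Gamma_set_def U2_set_def)
    have "R \<gamma>1 \<in> responses G \<psi>1 \<psi>2 k \<gamma>1" if \<gamma>1: "\<gamma>1 \<in> Gamma1_set G k" for \<gamma>1
    proof -
      have "action_cost G Follower \<psi>1 \<psi>2 k x (\<gamma>1 x, R \<gamma>1 x)
          \<le> action_cost G Follower \<psi>1 \<psi>2 k x (\<gamma>1 x, \<eta> x)"
        if "\<eta> \<in> Gamma2_set G k \<gamma>1" "x \<in> X_set G k" for \<eta> x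
        using strict[OF \<gamma>1 that(2) U2[OF that]] by fastforce
      then show ?thesis
        using R[OF \<gamma>1] traj_in_X_set[of G k] by (simp add: responses_def stage_cost_eq[OF k])
    qed
    moreover have "\<gamma>2 x = R \<gamma>1 x"
      if \<gamma>1: "\<gamma>1 \<in> Gamma1_set G k" and \<gamma>2: "\<gamma>2 \<in> responses G \<psi>1 \<psi>2 k \<gamma>1" and x: "x \<in> X_set G k"
      for \<gamma>1 \<gamma>2 x
    proof (rule ccontr)
      assume ne: "\<gamma>2 x \<noteq> R \<gamma>1 x"
      have "\<gamma>2 \<in> Gamma2_set G k \<gamma>1" using \<gamma>2 by (simp add: responses_def)
      note less = strict[OF \<gamma>1 x U2[OF this x] ne]
      \<comment> \<open>Responses are compared through total costs, so the disagreement at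
        \<open>x\<close> is detected only by upstream play that actually arrives at
        \<open>x\<close>.\<close>
      obtain \<phi>1 \<phi>2 where \<phi>: "upstream_admissible G k \<phi>1 \<phi>2" "traj G \<phi>1 \<phi>2 k = x"
        using reach[of k x] x k by auto
      with \<gamma>2 R[OF \<gamma>1] have "stage_cost G Follower \<psi>1 \<psi>2 k \<phi>1 \<phi>2 \<gamma>1 \<gamma>2
          \<le> stage_cost G Follower \<psi>1 \<psi>2 k \<phi>1 \<phi>2 \<gamma>1 (R \<gamma>1)" by (simp add: responses_def)
      then show False using less unfolding stage_cost_eq[OF k] \<phi>(2) by simp
    qed
    ultimately have "unique_response_map G \<psi>1 \<psi>2 k R" by (simp add: unique_response_map_def)
    moreover have "ctl \<psi>1 k \<in> Gamma1_set G k" using adm[OF k] by (auto simp: Gamma1_set_def)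
    moreover have "stage_cost G Leader \<psi>1 \<psi>2 k \<phi>1 \<phi>2 (ctl \<psi>1 k) (R (ctl \<psi>1 k))
                  \<le> stage_cost G Leader \<psi>1 \<psi>2 k \<phi>1 \<phi>2 \<gamma>1 (R \<gamma>1)"
      if "upstream_admissible G k \<phi>1 \<phi>2" "\<gamma>1 \<in> Gamma1_set G k" for \<phi>1 \<phi>2 \<gamma>1
      using lead[OF that(2) traj_in_X_set[OF that(1)]] by (simp add: stage_cost_eq[OF k])
    ultimately show ?thesis using foll by blast
  qed
  show ?thesis
    unfolding FSN_solution_def using terminal stage3 stages by (auto intro: less_imp_le)
qed

section \<open>Reachable sets are Borel\<close>

text \<open>Unlike the Borel sets, this class is preserved by continuous images; in Hausdorff spaces
  it is closed under intersection and consists of Borel sets.\<close>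

definition sigma_compact :: "'a::topological_space set \<Rightarrow> bool" where
  "sigma_compact S \<longleftrightarrow> (\<exists>\<C>. countable \<C> \<and> (\<forall>C\<in>\<C>. compact C) \<and> S = \<Union>\<C>)"

lemma compact_imp_sigma_compact: "compact S \<Longrightarrow> sigma_compact S"
  unfolding sigma_compact_def by (rule exI[of _ "{S}"]) auto

lemma closed_imp_sigma_compact:
  fixes S :: "'a::{real_normed_vector, heine_borel} set"
  assumes "closed S"
  shows "sigma_compact S"
proof -
  have "S = (\<Union>n. S \<inter> cball 0 (real n))"
  proof (intro equalityI subsetI)
    fix x assume "x \<in> S"
    moreover obtain n where "norm x \<le> real n" using real_arch_simple by blast
    ultimately show "x \<in> (\<Union>n. S \<inter> cball 0 (real n))" by auto
  qed blast
  moreover have "compact (S \<inter> cball 0 (real n))" for n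
    using assms by (intro closed_Int_compact compact_cball)
  ultimately show ?thesis
    unfolding sigma_compact_def
    by (intro exI[of _ "range (\<lambda>n. S \<inter> cball 0 (real n))"] conjI) (simp, blast, simp)
qed

lemma sigma_compact_image:
  assumes "sigma_compact S" "continuous_on UNIV f"
  shows "sigma_compact (f ` S)"
proof -
  obtain \<C> where \<C>: "countable \<C>" "\<And>C. C \<in> \<C> \<Longrightarrow> compact C" "S = \<Union>\<C>"
    using assms(1) by (auto simp: sigma_compact_def)
  have "compact (f ` C)" if "C \<in> \<C>" for C
    using compact_continuous_image[OF continuous_on_subset[OF assms(2)] \<C>(2)[OF that]] by simp
  then have "\<forall>D\<in>(`) f ` \<C>. compact D" by blast
  moreover have "countable ((`) f ` \<C>)" using \<C>(1) by simp
  moreover have "f ` S = \<Union>((`) f ` \<C>)" unfolding \<C>(3) by blast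
  ultimately show ?thesis unfolding sigma_compact_def by blast
qed

lemma sigma_compact_Int:
  fixes S :: "'a::t2_space set"
  assumes "sigma_compact S" "sigma_compact T"
  shows "sigma_compact (S \<inter> T)"
proof -
  obtain \<C> \<D> where \<C>: "countable \<C>" "\<And>C. C \<in> \<C> \<Longrightarrow> compact C" "S = \<Union>\<C>"
    and \<D>: "countable \<D>" "\<And>D. D \<in> \<D> \<Longrightarrow> compact D" "T = \<Union>\<D>"
    using assms by (auto simp: sigma_compact_def)
  let ?\<E> = "(\<lambda>(C, D). C \<inter> D) ` (\<C> \<times> \<D>)"
  have "countable ?\<E>" using \<C>(1) \<D>(1) by simp
  moreover have "\<forall>E\<in>?\<E>. compact E" using \<C>(2) \<D>(2) by (auto intro: compact_Int)
  moreover have "S \<inter> T = \<Union>?\<E>" unfolding \<C>(3) \<D>(3) by blast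
  ultimately show ?thesis unfolding sigma_compact_def by blast
qed

lemma sigma_compact_Times:
  assumes "sigma_compact S" "sigma_compact T"
  shows "sigma_compact (S \<times> T)"
proof -
  obtain \<C> \<D> where \<C>: "countable \<C>" "\<And>C. C \<in> \<C> \<Longrightarrow> compact C" "S = \<Union>\<C>"
    and \<D>: "countable \<D>" "\<And>D. D \<in> \<D> \<Longrightarrow> compact D" "T = \<Union>\<D>"
    using assms by (auto simp: sigma_compact_def)
  let ?\<E> = "(\<lambda>(C, D). C \<times> D) ` (\<C> \<times> \<D>)"
  have "countable ?\<E>" using \<C>(1) \<D>(1) by simp
  moreover have "\<forall>E\<in>?\<E>. compact E" using \<C>(2) \<D>(2) by (auto intro: compact_Times)
  moreover have "S \<times> T = \<Union>?\<E>" unfolding \<C>(3) \<D>(3) by blast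
  ultimately show ?thesis unfolding sigma_compact_def by blast
qed

lemma sigma_compact_borel:
  fixes S :: "'a::t2_space set"
  assumes "sigma_compact S"
  shows "S \<in> sets borel"
proof -
  obtain \<C> where \<C>: "countable \<C>" "\<And>C. C \<in> \<C> \<Longrightarrow> compact C" "S = \<Union>\<C>"
    using assms by (auto simp: sigma_compact_def)
  then have "\<C> \<subseteq> sets borel" by (auto intro: borel_closed compact_imp_closed)
  with \<C> show ?thesis by (simp add: sets.countable_Union)
qed

text \<open>These states form the projection of a closed set. Such a projection need not be closed
  in general, but it is a continuous image of a sigma-compact set.\<close>

lemma sigma_compact_feasible_states:
  assumes "continuous_on UNIV (\<lambda>(x, v). con1 G k x v)" "continuous_on UNIV (\<lambda>(x, v). con2 G k x v)"
  shows "sigma_compact {x. V_set G k x \<noteq> {}}"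
proof -
  let ?c1 = "\<lambda>(x, v). con1 G k x v" and ?c2 = "\<lambda>(x, v). con2 G k x v"
  let ?S = "?c1 -` {0..} \<inter> ?c2 -` {0..} \<inter> (\<lambda>z. fst (snd z)) -` {0..} \<inter> (\<lambda>z. snd (snd z)) -` {0..}"
  have "closed ?S"
    by (intro closed_Int closed_vimage[OF closed_eucl_atLeast] assms
        continuous_on_fst continuous_on_snd continuous_on_id)
  then have "sigma_compact (fst ` ?S)"
    by (intro sigma_compact_image[OF closed_imp_sigma_compact] continuous_on_fst continuous_on_id)
  moreover have "fst ` ?S = {x. V_set G k x \<noteq> {}}"
  proof -
    have "(x, v) \<in> ?S \<longleftrightarrow> v \<in> V_set G k x" for x v
      by (cases v) (simp add: V_set_def)
    then have "?S = {(x, v). v \<in> V_set G k x}" by blast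
    then show ?thesis by (auto simp: image_iff)
  qed
  ultimately show ?thesis by simp
qed

lemma sigma_compact_X_set:
  assumes "\<And>j. 0 < j \<Longrightarrow> j \<le> k \<Longrightarrow> continuous_on UNIV (\<lambda>(x, v). con1 G j x v)"
    and "\<And>j. 0 < j \<Longrightarrow> j \<le> k \<Longrightarrow> continuous_on UNIV (\<lambda>(x, v). con2 G j x v)"
    and "\<And>j. j < k \<Longrightarrow> continuous_on UNIV (\<lambda>(x, u). dyn G j x u)"
  shows "sigma_compact (X_set G k)"
  using assms
proof (induction k)
  case 0
  then show ?case by (simp add: compact_imp_sigma_compact)
next
  case (Suc k)
  \<comment> \<open>\<open>U_set\<close> restricts actions only through feasibility of the
    successor, so all actions may be applied first and infeasible successors discarded
    afterwards.\<close>
  have eq: "X_set G (Suc k) =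
      (\<lambda>(x, u). dyn G k x u) ` (X_set G k \<times> UNIV) \<inter> {x. V_set G (Suc k) x \<noteq> {}}"
    by (fastforce simp: U_set_def)
  have "sigma_compact (X_set G k)" using Suc by auto
  then have "sigma_compact ((\<lambda>(x, u). dyn G k x u) ` (X_set G k \<times> UNIV))"
    using Suc.prems
    by (intro sigma_compact_image sigma_compact_Times closed_imp_sigma_compact[OF closed_UNIV]) auto
  moreover have "sigma_compact {x. V_set G (Suc k) x \<noteq> {}}"
    using Suc.prems by (intro sigma_compact_feasible_states) auto
  ultimately show ?case unfolding eq by (rule sigma_compact_Int)
qed


section \<open>Subgames\<close>

lemma subgame_sets [simp]:
  "V_set (subgame G k x) j = V_set G (k + j)"
  "V1_set (subgame G k x) j = V1_set G (k + j)"
  "V2_set (subgame G k x) j = V2_set G (k + j)"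
  "U_set (subgame G k x) j = U_set G (k + j)"
  "U2_set (subgame G k x) j = U2_set G (k + j)"
  by (auto simp: subgame_def V_set_def V1_set_def V2_set_def U_set_def U2_set_def fun_eq_iff)

lemma X_set_subgame_subset:
  assumes "x \<in> X_set G k"
  shows "X_set (subgame G k x) j \<subseteq> X_set G (k + j)"
proof (induction j)
  case 0
  then show ?case using assms by (simp add: subgame_def)
next
  case (Suc j)
  have "dyn (subgame G k x) j = dyn G (k + j)" by (simp add: subgame_def)
  with Suc show ?case by fastforce
qed

lemma nash_at_subgame: "nash_at (subgame G k x) j = nash_at G (k + j)"
  by (auto simp: nash_at_def fun_eq_iff)

lemma stage_payoff_subgame:
  "k \<le> hor G \<Longrightarrow> stage_payoff (subgame G k x) i j = stage_payoff G i (k + j)"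
  by (auto simp: stage_payoff_def subgame_def fun_eq_iff)

text \<open>The number of remaining periods is unaffected by renumbering, so both sides carry the
  same \<open>n\<close>; this is the benefit of counting backwards.\<close>

lemma cost_to_go_subgame:
  assumes "k \<le> hor G" "n \<le> hor G - k"
  shows "cost_to_go (subgame G k x) i (truncation k \<psi>1) (truncation k \<psi>2) n y
    = cost_to_go G i \<psi>1 \<psi>2 n y"
  using assms(2)
proof (induction n arbitrary: y)
  case 0
  then show ?case using assms(1) by (simp add: subgame_def truncation_def)
next
  case (Suc n)
  then have "k + (hor G - k - Suc n) = hor G - Suc n" by simp
  then show ?case using Suc by (simp add: subgame_def truncation_def)
qed

lemma action_cost_subgame:
  assumes "k + j < hor G"
  shows "action_cost (subgame G k x) i (truncation k \<psi>1) (truncation k \<psi>2) j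
    = action_cost G i \<psi>1 \<psi>2 (k + j)"
proof -
  have "hor (subgame G k x) - Suc j = hor G - Suc (k + j)" by (simp add: subgame_def)
  then show ?thesis
    using assms by (auto simp: action_cost_def cost_to_go_subgame fun_eq_iff)
      (simp add: subgame_def truncation_def)
qed

section \<open>Moving admissible maps between a game and its subgame\<close>

lemma Gamma_set_subgame_restrict:
  assumes "(\<gamma>1, \<gamma>2) \<in> Gamma_set G (k + j)" "x \<in> X_set G k"
  shows "(\<gamma>1, \<gamma>2) \<in> Gamma_set (subgame G k x) j"
  using assms X_set_subgame_subset[OF assms(2), of j]
  by (auto simp: Gamma_set_def intro: measurable_restrict_mono)

text \<open>Gluing two measurable pieces requires the seam \<open>X'\<close> to be measurable; here
  the Borel property of reachable sets enters.\<close>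

lemma measurable_restrict_override:
  assumes "X' \<in> sets M" "X \<in> sets M" "X' \<subseteq> X"
    and "f \<in> measurable (restrict_space M X') N" "g \<in> measurable (restrict_space M X) N"
  shows "(\<lambda>x. if x \<in> X' then f x else g x) \<in> measurable (restrict_space M X) N"
proof -
  have X: "X \<subseteq> space M" using assms(2) by (rule sets.sets_into_space)
  have "{x \<in> space (restrict_space M X). x \<in> X'} = X'"
    using assms(3) X by (auto simp: space_restrict_space)
  then have "{x \<in> space (restrict_space M X). x \<in> X'} \<in> sets (restrict_space M X)"
    using assms by (simp add: sets_restrict_space_iff)
  moreover have "restrict_space (restrict_space M X) {x. x \<in> X'} = restrict_space M X'"
    using assms(3) by (simp add: restrict_restrict_space assms inf_absorb2)
  ultimately show ?thesis
    using assms(4,5) by (simp add: measurable_If_restrict_space_iff measurable_restrict_space1)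
qed

lemma Gamma_set_subgame_extend:
  assumes "(\<gamma>1, \<gamma>2) \<in> Gamma_set (subgame G k x) j" "(\<alpha>, \<beta>) \<in> Gamma_set G (k + j)"
    and "x \<in> X_set G k" "X_set (subgame G k x) j \<in> sets borel" "X_set G (k + j) \<in> sets borel"
  shows "(\<lambda>y. if y \<in> X_set (subgame G k x) j then \<gamma>1 y else \<alpha> y,
          \<lambda>y. if y \<in> X_set (subgame G k x) j then \<gamma>2 y else \<beta> y) \<in> Gamma_set G (k + j)"
  using assms X_set_subgame_subset[OF assms(3), of j]
  by (auto simp: Gamma_set_def intro: measurable_restrict_override)

lemma statewise_FSN_subgame:
  fixes G :: "('n::finite, 'm1::finite, 'm2::finite, 's1::finite, 's2::finite,
      'c1::finite, 'c2::finite) cnzdg"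
  assumes sw: "statewise_FSN G \<psi>1 \<psi>2" and k: "k \<le> hor G" and x: "x \<in> X_set G k"
    and meas: "\<And>j. j \<le> hor G - k \<Longrightarrow> X_set (subgame G k x) j \<in> sets borel"
      "\<And>j. j \<le> hor G \<Longrightarrow> X_set G j \<in> sets borel"
  shows "statewise_FSN (subgame G k x) (truncation k \<psi>1) (truncation k \<psi>2)"
proof -
  let ?G = "subgame G k x"
  let ?t1 = "truncation k \<psi>1" and ?t2 = "truncation k \<psi>2"
  note sub = subsetD[OF X_set_subgame_subset[OF x]]
  have hor: "hor ?G = hor G - k" by (simp add: subgame_def)
  have trunc: "ctl (truncation k \<psi>) j = ctl \<psi> (k + j)" "aux (truncation k \<psi>) j = aux \<psi> (k + j)"
    for \<psi> :: "('n, 'm::finite, 's::finite) strategy" and j by (simp_all add: truncation_def)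
  have nash: "nash_at ?G j y (\<lambda>i. stage_payoff ?G i j y u) (aux ?t1 j y) (aux ?t2 j y)"
    if "j \<le> hor ?G" "y \<in> X_set ?G j" "j < hor ?G \<longrightarrow> u \<in> U_set ?G j y" for j y u
  proof -
    have "k + j \<le> hor G" "k + j < hor G \<longrightarrow> u \<in> U_set G (k + j) y"
      using that k by (auto simp: hor)
    then show ?thesis
      using sw sub[OF that(2)]
      unfolding statewise_FSN_def nash_at_subgame stage_payoff_subgame[OF k] trunc
      by blast
  qed
  have stages: "(ctl ?t1 j, ctl ?t2 j) \<in> Gamma_set ?G j \<and>
      (\<exists>R. statewise_stackelberg ?G ?t1 ?t2 j R)"
    if j: "j < hor ?G" for j
  proof -
    have kj: "k + j < hor G" using j by (simp add: hor)
    have adm: "(ctl \<psi>1 (k + j), ctl \<psi>2 (k + j)) \<in> Gamma_set G (k + j)"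
      using sw kj unfolding statewise_FSN_def by blast
    \<comment> \<open>Filling up with the solution's own control leaves that control literally
      unchanged (\<open>ext_ctl\<close>). The leader's and follower's conditions then transfer
      without comparing \<open>R\<close> at two maps that merely agree on a subset.\<close>
    define ext where "ext \<gamma> = (\<lambda>y. if y \<in> X_set ?G j then \<gamma> y else ctl \<psi>1 (k + j) y)" for \<gamma>
    have ext_ctl: "ext (ctl \<psi>1 (k + j)) = ctl \<psi>1 (k + j)" by (auto simp: ext_def)
    have ext_at: "ext \<gamma> y = \<gamma> y" if "y \<in> X_set ?G j" for \<gamma> y using that by (simp add: ext_def)
    have ext: "ext \<gamma> \<in> Gamma1_set G (k + j)" if "\<gamma> \<in> Gamma1_set ?G j" for \<gamma>
      using that Gamma_set_subgame_extend[OF _ adm x meas(1) meas(2)] kj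
      by (force simp: Gamma1_set_def ext_def)
    from sw kj obtain R where "statewise_stackelberg G \<psi>1 \<psi>2 (k + j) R"
      unfolding statewise_FSN_def by blast
    then have R: "\<And>\<gamma>1. \<gamma>1\<in>Gamma1_set G (k + j) \<Longrightarrow> R \<gamma>1 \<in> Gamma2_set G (k + j) \<gamma>1"
      and strict: "\<And>\<gamma>1 x u2. \<gamma>1\<in>Gamma1_set G (k + j) \<Longrightarrow> x\<in>X_set G (k + j) \<Longrightarrow>
               u2\<in>U2_set G (k + j) x (\<gamma>1 x) \<Longrightarrow> u2 \<noteq> R \<gamma>1 x \<Longrightarrow>
               action_cost G Follower \<psi>1 \<psi>2 (k + j) x (\<gamma>1 x, R \<gamma>1 x)
                    < action_cost G Follower \<psi>1 \<psi>2 (k + j) x (\<gamma>1 x, u2)"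
      and lead: "\<And>\<gamma>1 x. \<gamma>1\<in>Gamma1_set G (k + j) \<Longrightarrow> x\<in>X_set G (k + j) \<Longrightarrow>
               action_cost G Leader \<psi>1 \<psi>2 (k + j) x (ctl \<psi>1 (k + j) x, R (ctl \<psi>1 (k + j)) x)
                  \<le> action_cost G Leader \<psi>1 \<psi>2 (k + j) x (\<gamma>1 x, R \<gamma>1 x)"
      and foll: "\<And>x. x\<in>X_set G (k + j) \<Longrightarrow> ctl \<psi>2 (k + j) x = R (ctl \<psi>1 (k + j)) x"
      unfolding statewise_stackelberg_def by blast+
    \<comment> \<open>The subgame's response is inherited: extend the leader's map, respond in the
      full game, and read the result on the smaller reachable set.\<close>
    define R' where "R' \<gamma> = R (ext \<gamma>)" for \<gamma>
    have "R' \<gamma> \<in> Gamma2_set ?G j \<gamma>" if "\<gamma> \<in> Gamma1_set ?G j" for \<gamma>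
    proof -
      have "(ext \<gamma>, R' \<gamma>) \<in> Gamma_set ?G j"
        using R[OF ext[OF that]] x
        by (intro Gamma_set_subgame_restrict) (auto simp: Gamma2_set_def R'_def)
      then show ?thesis
        using that by (auto simp: Gamma1_set_def Gamma2_set_def Gamma_set_def ext_at)
    qed
    moreover have "action_cost ?G Follower ?t1 ?t2 j y (\<gamma> y, R' \<gamma> y)
                    < action_cost ?G Follower ?t1 ?t2 j y (\<gamma> y, u2)"
      if "\<gamma> \<in> Gamma1_set ?G j" "y \<in> X_set ?G j" "u2 \<in> U2_set ?G j y (\<gamma> y)" "u2 \<noteq> R' \<gamma> y" for \<gamma> y u2
      using strict[OF ext[OF that(1)] sub[OF that(2)], of u2] that
      by (simp add: action_cost_subgame[OF kj] ext_at R'_def)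
    moreover have "action_cost ?G Leader ?t1 ?t2 j y (ctl ?t1 j y, R' (ctl ?t1 j) y)
                  \<le> action_cost ?G Leader ?t1 ?t2 j y (\<gamma> y, R' \<gamma> y)"
      if "\<gamma> \<in> Gamma1_set ?G j" "y \<in> X_set ?G j" for \<gamma> y
      using lead[OF ext[OF that(1)] sub[OF that(2)]] that
      by (simp add: action_cost_subgame[OF kj] ext_at R'_def trunc ext_ctl)
    moreover have "ctl ?t2 j y = R' (ctl ?t1 j) y" if "y \<in> X_set ?G j" for y
      using foll[OF sub[OF that]] by (simp add: trunc R'_def ext_ctl)
    moreover have "(ctl ?t1 j, ctl ?t2 j) \<in> Gamma_set ?G j"
      unfolding trunc using adm x by (rule Gamma_set_subgame_restrict)
    ultimately show ?thesis unfolding statewise_stackelberg_def by blast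
  qed
  show ?thesis unfolding statewise_FSN_def using nash stages by blast
qed


section \<open>The recursion yields a solution\<close>

text \<open>Fixing the opponent's decision splits the joint problem into one complementarity system
  per player, over a convex slice of \<open>V_set\<close>.\<close>

lemma SOL_pCP_imp_nash_at:
  fixes G :: "('n::finite, 'm1::finite, 'm2::finite, 's1::finite, 's2::finite,
      'c1::finite, 'c2::finite) cnzdg"
  assumes SOL: "((v1, v2), \<mu>) \<in> SOL_pCP G gv k x"
    and V: "convex (V_set G k x)"
    and diff: "\<And>i z. (gv i k x) differentiable at z"
      "\<And>z. (con1 G k x) differentiable at z" "\<And>z. (con2 G k x) differentiable at z"
    and dsc: "\<And>\<alpha> \<beta>. \<alpha> \<noteq> \<beta> \<Longrightarrow>
        (\<alpha> - \<beta>) \<bullet> pseudo_grad (\<lambda>i. gv i k x) \<beta> + (\<beta> - \<alpha>) \<bullet> pseudo_grad (\<lambda>i. gv i k x) \<alpha> < 0"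
  shows "nash_at G k x (\<lambda>i. gv i k x) v1 v2"
proof -
  obtain \<mu>1 \<mu>2 where \<mu>: "\<mu> = (\<mu>1, \<mu>2)" by fastforce
  define F1 where "F1 w = gv Leader k x (w, v2)" for w
  define F2 where "F2 w = gv Follower k x (v1, w)" for w
  define h1 where "h1 w = con1 G k x (w, v2)" for w
  define h2 where "h2 w = con2 G k x (v1, w)" for w
  define l1 where "l1 = grad F1 v1 - transpose (jacobian h1 (at v1)) *v \<mu>1"
  define l2 where "l2 = grad F2 v2 - transpose (jacobian h2 (at v2)) *v \<mu>2"
  have "complementary ((l1, l2), (h1 v1, h2 v2)) ((v1, v2), (\<mu>1, \<mu>2))"
    using SOL by (simp add: SOL_pCP_def grad_L_def pseudo_grad_def jac_con1_def jac_con2_def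
        \<mu> l1_def l2_def F1_def[abs_def] F2_def[abs_def] h1_def[abs_def] h2_def[abs_def])
  then have nonneg: "0 \<le> l1" "0 \<le> l2" "0 \<le> h1 v1" "0 \<le> h2 v2" "0 \<le> v1" "0 \<le> v2" "0 \<le> \<mu>1" "0 \<le> \<mu>2"
    and sum0: "l1 \<bullet> v1 + l2 \<bullet> v2 + (h1 v1 \<bullet> \<mu>1 + h2 v2 \<bullet> \<mu>2) = 0"
    by (auto simp: complementary_def less_eq_prod_def)
  have inner_nonneg: "0 \<le> a \<bullet> b" if "0 \<le> a" "0 \<le> b" for a b :: "real^'d::finite"
    using that by (auto simp: inner_vec_def less_eq_vec_def intro!: sum_nonneg)
  \<comment> \<open>The joint orthogonality is one equation, but a sum of four nonnegative terms;
    each therefore vanishes.\<close>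
  have "0 \<le> l1 \<bullet> v1" "0 \<le> l2 \<bullet> v2" "0 \<le> h1 v1 \<bullet> \<mu>1" "0 \<le> h2 v2 \<bullet> \<mu>2"
    by (intro inner_nonneg nonneg)+
  with sum0 have compl: "l1 \<bullet> v1 = 0" "l2 \<bullet> v2 = 0" "h1 v1 \<bullet> \<mu>1 = 0" "h2 v2 \<bullet> \<mu>2 = 0"
    by linarith+
  have v: "(v1, v2) \<in> V_set G k x"
    using nonneg by (simp add: V_set_def h1_def h2_def)
  have pair1: "f \<circ> (\<lambda>w. (w, v2)) differentiable at z"
    if "\<And>z. f differentiable at z" for f :: "_ \<Rightarrow> 'b::real_normed_vector" and z
    using that by (intro differentiable_chain_at) (auto intro: derivative_intros simp: differentiable_Pair)
  have pair2: "f \<circ> (\<lambda>w. (v1, w)) differentiable at z"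
    if "\<And>z. f differentiable at z" for f :: "_ \<Rightarrow> 'b::real_normed_vector" and z
    using that by (intro differentiable_chain_at) (auto intro: derivative_intros simp: differentiable_Pair)
  have diffs: "F1 differentiable at z1" "h1 differentiable at z1"
      "F2 differentiable at z2" "h2 differentiable at z2" for z1 z2
    using pair1[OF diff(1)] pair1[OF diff(2)] pair2[OF diff(1)] pair2[OF diff(3)]
    by (simp_all add: o_def F1_def[abs_def] F2_def[abs_def] h1_def[abs_def] h2_def[abs_def])
  \<comment> \<open>For two points sharing the follower's decision, the follower's block of the
    pseudogradient drops out of \<open>dsc\<close>.\<close>
  have mono1: "0 \<le> (a - b) \<bullet> (grad F1 a - grad F1 b)" for a b
    using dsc[of "(a, v2)" "(b, v2)"]
    by (cases "a = b") (auto simp: pseudo_grad_def F1_def[abs_def] inner_diff)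
  have mono2: "0 \<le> (a - b) \<bullet> (grad F2 a - grad F2 b)" for a b
    using dsc[of "(v1, a)" "(v1, b)"]
    by (cases "a = b") (auto simp: pseudo_grad_def F2_def[abs_def] inner_diff)
  have "F1 v1 \<le> F1 w" if "w \<in> V1_set G k x v2" for w
  proof (rule complementarity_sufficient[OF diffs(1) mono1 diffs(2) _ _ that _ _
        nonneg(1)[unfolded l1_def] compl(1)[unfolded l1_def] nonneg(7) compl(3)])
    show "convex (V1_set G k x v2)"
      unfolding convex_def
    proof (intro ballI allI impI)
      fix a b and s t :: real
      assume "a \<in> V1_set G k x v2" "b \<in> V1_set G k x v2" and st: "0 \<le> s" "0 \<le> t" "s + t = 1"
      then have "s *\<^sub>R (a, v2) + t *\<^sub>R (b, v2) \<in> V_set G k x"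
        using V unfolding convex_def V1_set_def by blast
      then show "s *\<^sub>R a + t *\<^sub>R b \<in> V1_set G k x v2"
        using st by (simp add: V1_set_def scaleR_add_left[symmetric])
    qed
    show "v1 \<in> V1_set G k x v2" using v by (simp add: V1_set_def)
    show "0 \<le> h1 z" if "z \<in> V1_set G k x v2" for z
      using that by (simp add: V1_set_def V_set_def h1_def)
    show "0 \<le> w" using that by (simp add: V1_set_def V_set_def)
  qed
  moreover have "F2 v2 \<le> F2 w" if "w \<in> V2_set G k x v1" for w
  proof (rule complementarity_sufficient[OF diffs(3) mono2 diffs(4) _ _ that _ _
        nonneg(2)[unfolded l2_def] compl(2)[unfolded l2_def] nonneg(8) compl(4)])
    show "convex (V2_set G k x v1)"
      unfolding convex_def
    proof (intro ballI allI impI)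
      fix a b and s t :: real
      assume "a \<in> V2_set G k x v1" "b \<in> V2_set G k x v1" and st: "0 \<le> s" "0 \<le> t" "s + t = 1"
      then have "s *\<^sub>R (v1, a) + t *\<^sub>R (v1, b) \<in> V_set G k x"
        using V unfolding convex_def V2_set_def by blast
      then show "s *\<^sub>R a + t *\<^sub>R b \<in> V2_set G k x v1"
        using st by (simp add: V2_set_def scaleR_add_left[symmetric])
    qed
    show "v2 \<in> V2_set G k x v1" using v by (simp add: V2_set_def)
    show "0 \<le> h2 z" if "z \<in> V2_set G k x v1" for z
      using that by (simp add: V2_set_def V_set_def h2_def)
    show "0 \<le> w" using that by (simp add: V2_set_def V_set_def)
  qed
  ultimately show ?thesis using v by (simp add: nash_at_def F1_def F2_def)
qed

text \<open>Minimality among maps yields minimality among actions: the competing map is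
  \<open>r\<close> changed at \<open>x\<close> alone.\<close>

lemma statewise_argmin_at:
  fixes G :: "('n::finite, 'm1::finite, 'm2::finite, 's1::finite, 's2::finite,
      'c1::finite, 'c2::finite) cnzdg"
    and c :: "real^'n \<Rightarrow> (real^'m1) \<times> (real^'m2) \<Rightarrow> real"
  assumes r: "r \<in> statewise_argmin (X_set G k) (Gamma2_set G k \<gamma>) (\<lambda>\<eta> x. c x (\<gamma> x, \<eta> x))"
    and x: "x \<in> X_set G k" and u2: "u2 \<in> U2_set G k x (\<gamma> x)"
  shows "c x (\<gamma> x, r x) \<le> c x (\<gamma> x, u2)"
proof -
  have "(\<gamma>, r) \<in> Gamma_set G k" using r by (simp add: statewise_argmin_def Gamma2_set_def)
  then have "(\<gamma>(x := \<gamma> x), r(x := u2)) \<in> Gamma_set G k"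
    using u2 by (intro Gamma_set_upd) (auto simp: U2_set_def)
  then have "r(x := u2) \<in> Gamma2_set G k \<gamma>" by (simp add: Gamma2_set_def)
  then have "c x (\<gamma> x, r x) \<le> c x (\<gamma> x, (r(x := u2)) x)"
    using r x unfolding statewise_argmin_def by blast
  then show ?thesis by simp
qed

text \<open>Were \<open>f b\<close> no larger than \<open>f a\<close>, the midpoint would beat the
  minimizer \<open>a\<close>.\<close>

lemma strictly_convex_on_unique_min:
  assumes "strictly_convex_on S f" "a \<in> S" "b \<in> S" "a \<noteq> b"
    and "\<And>z. z \<in> S \<Longrightarrow> f a \<le> f z"
  shows "f a < f b"
proof -
  let ?m = "(1 - 1/2) *\<^sub>R a + (1/2 :: real) *\<^sub>R b"
  have "f ?m < (1 - 1/2) * f a + 1/2 * f b"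
    using assms(1)[unfolded strictly_convex_on_def, THEN conjunct2, rule_format, OF assms(2,3), of "1/2"]
      assms(4) by simp
  moreover have "?m \<in> S"
    using assms(1)[unfolded strictly_convex_on_def, THEN conjunct1] assms(2,3)
    by (intro convexD) auto
  then have "f a \<le> f ?m" by (rule assms(5))
  ultimately show ?thesis by simp
qed

theorem mainTheorem2:
  fixes G :: "('n::finite, 'm1::finite, 'm2::finite, 's1::finite, 's2::finite,
      'c1::finite, 'c2::finite) cnzdg"
    and gu :: "player \<Rightarrow> nat \<Rightarrow> real^'n \<Rightarrow> (real^'m1) \<times> (real^'m2) \<Rightarrow> real"
    and gv :: "player \<Rightarrow> nat \<Rightarrow> real^'n \<Rightarrow> (real^'s1) \<times> (real^'s2) \<Rightarrow> real"
    and W :: "player \<Rightarrow> nat \<Rightarrow> real^'n \<Rightarrow> real"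
    and R :: "nat \<Rightarrow> (real^'n \<Rightarrow> real^'m1) \<Rightarrow> (real^'n \<Rightarrow> real^'m2)"
    and \<gamma>1 :: "nat \<Rightarrow> real^'n \<Rightarrow> real^'m1" and \<gamma>2 :: "nat \<Rightarrow> real^'n \<Rightarrow> real^'m2"
    and v1 :: "nat \<Rightarrow> real^'n \<Rightarrow> real^'s1" and v2 :: "nat \<Rightarrow> real^'n \<Rightarrow> real^'s2"
    and \<mu> :: "nat \<Rightarrow> real^'n \<Rightarrow> (real^'c1) \<times> (real^'c2)"
  assumes a_V: "\<And>k x. k \<le> hor G \<Longrightarrow> x \<in> X_set G k \<Longrightarrow>
        V_set G k x \<noteq> {} \<and> convex (V_set G k x) \<and> closed (V_set G k x) \<and> bounded (V_set G k x)"
    and a_dyn: "\<And>k. k < hor G \<Longrightarrow> continuously_differentiable (\<lambda>(x, u). dyn G k x u)"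
    and a_con1: "\<And>k. k \<le> hor G \<Longrightarrow> continuously_differentiable (\<lambda>(x, v). con1 G k x v)"
    and a_con2: "\<And>k. k \<le> hor G \<Longrightarrow> continuously_differentiable (\<lambda>(x, v). con2 G k x v)"
    and a_cost: "\<And>i k. k < hor G \<Longrightarrow> continuously_differentiable (\<lambda>(x, u, v). cost G i k x u v)"
    and a_term: "\<And>i. continuously_differentiable (\<lambda>(x, v). term_cost G i x v)"
    and a_rank: "\<And>k x v. k \<le> hor G \<Longrightarrow> x \<in> X_set G k \<Longrightarrow> v \<in> V_set G k x \<Longrightarrow>
        full_rank (jac_con1 G k x v) \<and> full_rank (jac_con2 G k x v)"
    and b_sep: "\<And>i k x u v. k < hor G \<Longrightarrow> cost G i k x u v = gu i k x u + gv i k x v"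
    and b_term: "\<And>i x v. gv i (hor G) x v = term_cost G i x v"
    and c_dsc: "\<And>k x \<alpha> \<beta>. k \<le> hor G \<Longrightarrow> x \<in> X_set G k \<Longrightarrow> \<alpha> \<noteq> \<beta> \<Longrightarrow>
        (\<alpha> - \<beta>) \<bullet> pseudo_grad (\<lambda>i. gv i k x) \<beta> + (\<beta> - \<alpha>) \<bullet> pseudo_grad (\<lambda>i. gv i k x) \<alpha> < 0"
    and W_convex: "\<And>k x \<gamma>. k < hor G \<Longrightarrow> \<gamma> \<in> Gamma1_set G k \<Longrightarrow> x \<in> X_set G k \<Longrightarrow>
        strictly_convex_on (U2_set G k x (\<gamma> x))
          (\<lambda>u2. gu Follower k x (\<gamma> x, u2) + W Follower (Suc k) (dyn G k x (\<gamma> x, u2)))"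
    and SOL: "\<And>k x. k \<le> hor G \<Longrightarrow> x \<in> X_set G k \<Longrightarrow>
        SOL_pCP G gv k x = {((v1 k x, v2 k x), \<mu> k x)}"
    and W_term: "\<And>i x. x \<in> X_set G (hor G) \<Longrightarrow>
        W i (hor G) x = term_cost G i x (v1 (hor G) x, v2 (hor G) x)"
    and W_rec: "\<And>i k x. k < hor G \<Longrightarrow> x \<in> X_set G k \<Longrightarrow>
        W i k x = cost G i k x (\<gamma>1 k x, \<gamma>2 k x) (v1 k x, v2 k x)
          + W i (Suc k) (dyn G k x (\<gamma>1 k x, \<gamma>2 k x))"
    and response: "\<And>k \<gamma>. k < hor G \<Longrightarrow> \<gamma> \<in> Gamma1_set G k \<Longrightarrow>
        R k \<gamma> \<in> statewise_argmin (X_set G k) (Gamma2_set G k \<gamma>)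
          (\<lambda>\<eta> x. gu Follower k x (\<gamma> x, \<eta> x) + W Follower (Suc k) (dyn G k x (\<gamma> x, \<eta> x)))"
    and leader: "\<And>k. k < hor G \<Longrightarrow>
        \<gamma>1 k \<in> statewise_argmin (X_set G k) (Gamma1_set G k)
          (\<lambda>\<gamma> x. gu Leader k x (\<gamma> x, R k \<gamma> x) + W Leader (Suc k) (dyn G k x (\<gamma> x, R k \<gamma> x)))"
    and follower: "\<And>k x. k < hor G \<Longrightarrow> x \<in> X_set G k \<Longrightarrow> \<gamma>2 k x = R k (\<gamma>1 k) x"
  shows "FSN_solution G \<lparr>ctl = \<gamma>1, aux = v1\<rparr> \<lparr>ctl = \<gamma>2, aux = v2\<rparr> \<and>
    (\<forall>\<psi>1 \<psi>2. FSN_solution G \<psi>1 \<psi>2 \<longrightarrow> strongly_time_consistent G \<psi>1 \<psi>2)"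
proof -
  let ?\<psi>1 = "\<lparr>ctl = \<gamma>1, aux = v1\<rparr>" and ?\<psi>2 = "\<lparr>ctl = \<gamma>2, aux = v2\<rparr>"
  have adm1: "\<gamma>1 k \<in> Gamma1_set G k" if "k < hor G" for k
    using leader[OF that] by (simp add: statewise_argmin_def)
  have R_adm: "R k \<gamma> \<in> Gamma2_set G k \<gamma>" if "k < hor G" "\<gamma> \<in> Gamma1_set G k" for k \<gamma>
    using response[OF that] by (simp add: statewise_argmin_def)
  have adm: "(\<gamma>1 k, \<gamma>2 k) \<in> Gamma_set G k" if "k < hor G" for k
    using R_adm[OF that adm1[OF that]] follower[OF that]
    by (auto simp: Gamma2_set_def intro: Gamma_set_cong)
  \<comment> \<open>Backward induction; admissibility of the recursion's maps keeps the next state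
    reachable, where the induction hypothesis applies.\<close>
  have W: "cost_to_go G i ?\<psi>1 ?\<psi>2 (hor G - k) x = W i k x" if "k \<le> hor G" "x \<in> X_set G k" for i k x
    using that
  proof (induction arbitrary: x rule: inc_induct)
    case base
    then show ?case by (simp add: W_term)
  next
    case (step k)
    then have "(\<gamma>1 k x, \<gamma>2 k x) \<in> U_set G k x" using adm[of k] by (auto simp: Gamma_set_def)
    then have "dyn G k x (\<gamma>1 k x, \<gamma>2 k x) \<in> X_set G (Suc k)" using step by auto
    with step show ?case by (simp add: cost_to_go_unfold action_cost_def W_rec)
  qed
  \<comment> \<open>By separability the decision term is constant in \<open>u\<close>, so the
    minimizations in the recursion are minimizations of \<open>action_cost\<close>.\<close>
  have act: "action_cost G i ?\<psi>1 ?\<psi>2 k x u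
      = gu i k x u + W i (Suc k) (dyn G k x u) + gv i k x (v1 k x, v2 k x)"
    if "k < hor G" "x \<in> X_set G k" "u \<in> U_set G k x" for i k x u
  proof -
    have "dyn G k x u \<in> X_set G (Suc k)" using that unfolding X_set.simps by blast
    then show ?thesis using W[of "Suc k"] that by (simp add: action_cost_def b_sep)
  qed
  have diff_con1: "(con1 G k x) differentiable at z" and diff_con2: "(con2 G k x) differentiable at z"
    if "k \<le> hor G" for k x z
  proof -
    have P: "(\<lambda>v. (x, v)) differentiable at z" for z :: "(real^'s1) \<times> (real^'s2)"
      by (intro differentiable_Pair differentiable_const differentiable_ident)
    show "(con1 G k x) differentiable at z" "(con2 G k x) differentiable at z"
      using differentiable_chain_at[OF P continuously_differentiable_imp_differentiable[OF a_con1[OF that]]]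
        differentiable_chain_at[OF P continuously_differentiable_imp_differentiable[OF a_con2[OF that]]]
      by (simp_all add: o_def)
  qed
  have diff_gv: "(gv i k x) differentiable at z" if "k \<le> hor G" for i k x z
  proof (cases "k = hor G")
    case True
    have P: "(\<lambda>v. (x, v)) differentiable at z" for z :: "(real^'s1) \<times> (real^'s2)"
      by (intro differentiable_Pair differentiable_const differentiable_ident)
    have "(\<lambda>v. term_cost G i x v) differentiable at z"
      using differentiable_chain_at[OF P continuously_differentiable_imp_differentiable[OF a_term]]
      by (simp add: o_def)
    moreover have "gv i (hor G) x = (\<lambda>v. term_cost G i x v)" by (simp add: b_term fun_eq_iff)
    ultimately show ?thesis by (simp add: True)
  next
    case False
    then have k: "k < hor G" using that by simp
    \<comment> \<open>Smoothness is assumed of \<open>cost\<close>, not of its parts. Up to the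
      constant \<open>gu i k x 0\<close>, \<open>gv\<close> is the stage cost at the arbitrary
      action 0.\<close>
    have P: "(\<lambda>v. (x, 0 :: (real^'m1) \<times> (real^'m2), v)) differentiable at z"
      for z :: "(real^'s1) \<times> (real^'s2)"
      by (intro differentiable_Pair differentiable_const differentiable_ident)
    have "(\<lambda>v. cost G i k x 0 v - gu i k x 0) differentiable at z"
      using differentiable_chain_at[OF P continuously_differentiable_imp_differentiable[OF a_cost[OF k]]]
      by (intro differentiable_diff) (auto simp: o_def)
    moreover have "(\<lambda>v. cost G i k x 0 v - gu i k x 0) = gv i k x" by (simp add: b_sep[OF k])
    ultimately show ?thesis by simp
  qed
  have "statewise_FSN G ?\<psi>1 ?\<psi>2"
    unfolding statewise_FSN_def
  proof (intro conjI allI impI ballI)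
    fix k x u
    assume k: "k \<le> hor G" and x: "x \<in> X_set G k"
    have "nash_at G k x (\<lambda>i. gv i k x) (v1 k x) (v2 k x)"
      using SOL[OF k x] a_V[OF k x] diff_gv[OF k] diff_con1[OF k] diff_con2[OF k] c_dsc[OF k x]
      by (intro SOL_pCP_imp_nash_at[of _ _ "\<mu> k x"]) auto
    moreover have "stage_payoff G i k x u v = (if k < hor G then gu i k x u else 0) + gv i k x v" for i v
      using k by (cases "k = hor G") (auto simp: stage_payoff_def b_sep b_term)
    ultimately show "nash_at G k x (\<lambda>i. stage_payoff G i k x u) (aux ?\<psi>1 k x) (aux ?\<psi>2 k x)"
      by (simp add: nash_at_def)
  next
    fix k assume k: "k < hor G"
    then show "(ctl ?\<psi>1 k, ctl ?\<psi>2 k) \<in> Gamma_set G k" using adm by simp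
    have U: "(\<gamma> x, R k \<gamma> x) \<in> U_set G k x" if "\<gamma> \<in> Gamma1_set G k" "x \<in> X_set G k" for \<gamma> x
      using R_adm[OF k that(1)] that(2) by (auto simp: Gamma2_set_def Gamma_set_def)
    have strict: "action_cost G Follower ?\<psi>1 ?\<psi>2 k x (\<gamma> x, R k \<gamma> x)
        < action_cost G Follower ?\<psi>1 ?\<psi>2 k x (\<gamma> x, u2)"
      if \<gamma>: "\<gamma> \<in> Gamma1_set G k" and x: "x \<in> X_set G k" and u2: "u2 \<in> U2_set G k x (\<gamma> x)"
        and ne: "u2 \<noteq> R k \<gamma> x" for \<gamma> x u2
    proof -
      define c where "c y u = gu Follower k y u + W Follower (Suc k) (dyn G k y u)" for y u
      have "c x (\<gamma> x, R k \<gamma> x) < c x (\<gamma> x, u2)"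
      proof (rule strictly_convex_on_unique_min[where f = "\<lambda>u. c x (\<gamma> x, u)"])
        show "strictly_convex_on (U2_set G k x (\<gamma> x)) (\<lambda>u. c x (\<gamma> x, u))"
          using W_convex[OF k \<gamma> x] by (simp add: c_def)
        show "R k \<gamma> x \<in> U2_set G k x (\<gamma> x)" using U[OF \<gamma> x] by (simp add: U2_set_def)
        show "c x (\<gamma> x, R k \<gamma> x) \<le> c x (\<gamma> x, z)" if "z \<in> U2_set G k x (\<gamma> x)" for z
          using response[OF k \<gamma>] x that by (intro statewise_argmin_at) (simp_all add: c_def)
      qed (use u2 ne in auto)
      then show ?thesis using U[OF \<gamma> x] u2 by (simp add: act k x U2_set_def c_def)
    qed
    have lead: "action_cost G Leader ?\<psi>1 ?\<psi>2 k x (\<gamma>1 k x, R k (\<gamma>1 k) x)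
        \<le> action_cost G Leader ?\<psi>1 ?\<psi>2 k x (\<gamma> x, R k \<gamma> x)"
      if \<gamma>: "\<gamma> \<in> Gamma1_set G k" and x: "x \<in> X_set G k" for \<gamma> x
      using leader[OF k] \<gamma> x U[OF \<gamma> x] U[OF adm1[OF k] x]
      by (auto simp: statewise_argmin_def act k x)
    show "\<exists>R. statewise_stackelberg G ?\<psi>1 ?\<psi>2 k R"
      unfolding statewise_stackelberg_def
      using R_adm[OF k] strict lead follower[OF k] by (intro exI[of _ "R k"]) simp
  qed
  then have solution: "FSN_solution G ?\<psi>1 ?\<psi>2" by (rule statewise_imp_FSN)
  note cont = a_con1[THEN continuously_differentiable_imp_continuous]
    a_con2[THEN continuously_differentiable_imp_continuous]
    a_dyn[THEN continuously_differentiable_imp_continuous]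
  have borel: "X_set G k \<in> sets borel" if "k \<le> hor G" for k
    using that by (intro sigma_compact_borel sigma_compact_X_set) (auto intro: cont)
  have borel_sub: "X_set (subgame G k x) j \<in> sets borel" if "k \<le> hor G" "j \<le> hor G - k" for k x j
    using that by (intro sigma_compact_borel sigma_compact_X_set) (auto intro!: cont simp: subgame_def)
  have "strongly_time_consistent G \<psi>1 \<psi>2" if "FSN_solution G \<psi>1 \<psi>2" for \<psi>1 \<psi>2
    unfolding strongly_time_consistent_def
    using FSN_imp_statewise[OF that] a_V borel borel_sub
    by (intro allI impI ballI statewise_imp_FSN statewise_FSN_subgame) auto
  with solution show ?thesis by blast
qed

end
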